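(* Let $R$ be a $C$-algebra, $U$ a left $R$-module with the FRCP, $Z$ an injective cogenerator in the category of (right) $C$-modules, $U^*=\mathrm{Hom}_C(U,Z)$ and $C'=\mathrm{End}_C(Z)$. Let $\mathrm{End}_{C',R}(U^* )$ be the ring of all $C',R$-bimodule endomorphisms of $U^*$. Then $$\mathrm{Biend}_R(U)\subseteq\mathrm{End}_{\mathrm{End}_{C',R}(U^* )}(U^* )\cap\mathrm{End}_{C'}(U^* ),$$ where $\mathrm{Biend}_R(U)$ is identified with $\{g^*:\ g\in\mathrm{Biend}_R(U)\}$. In particular, if $C'=C$, then $$\mathrm{Biend}_R(U)\subseteq\mathrm{Biend}_R(U^* ).$$
   Context: All rings and modules are unital. A $C$-algebra is a ring $R$ containing $C$ as a subring of its center, with the same identity (so $C$ is commutative). Every left $R$-module $U$ is a $C$-module via $uc=cu$. A cogenerator $Z$ is a $C$-module such that for every $C$-module $W$ and $0\ne w\in W$ there is $f\in\mathrm{Hom}_C(W,Z)$ with $f(w)\ne 0$. $C'=\mathrm{End}_C(Z)$, and $C$ is regarded as a subring of $C'$ via multiplications on $Z$ (so $C'=C$ means that every $C$-endomorphism of $Z$ is multiplication by an element of $C$). $U^*=\mathrm{Hom}_C(U,Z)$ is a $C',R$-bimodule via $t\rho=t\circ\rho$ and $(\rho r)(u)=\rho(ru)$. For a left or right $R$-module $X$, $\mathrm{Biend}_R(X)=\mathrm{End}_{\mathrm{End}_R(X)}(X)$, the ring of additive maps $X\to X$ commuting with all $R$-endomorphisms of $X$. Each $g\in\mathrm{Biend}_R(U)$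 is $C$-linear and its adjoint is $g^*:U^*\to U^*$, $g^*(\rho)=\rho\circ g$; the inclusions mean that all these $g^*$ belong to the right-hand side. $\mathrm{End}_{\mathrm{End}_{C',R}(U^* )}(U^* )$ is the set of additive maps on $U^*$ commuting with all elements of $\mathrm{End}_{C',R}(U^* )$. A finitely related module is a quotient of a free module (of any rank) by a finitely generated submodule. A left $R$-module $U$ has the FRCP (finitely related complementation property) if $U$ is a direct summand in a left $R$-module $W$ such that each finite subset of $W$ is contained in a finitely related direct summand of $W$. *)

theory Defs
  imports "HOL-Algebra.Module" "HOL-Algebra.Subrings" "HOL-Algebra.AbelCoset"
begin

section \<open>Modules over rings that need not be commutative\<close>

text \<open>The library locale \<^locale>\<open>module\<close> is restricted to commutative base rings; this is the
  same list of axioms over an arbitrary ring.  It is used for left \<open>R\<close>-modules, while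
  \<open>C\<close>-modules are modules in the sense of the library.  The fields \<open>mult\<close> and \<open>one\<close> of a
  module record carry no meaning.\<close>

locale left_module = R?: ring R + M?: abelian_group M
  for R :: "('a, 'c) ring_scheme" (structure) and M :: "('a, 'b, 'd) module_scheme" (structure) +
  assumes smult_closed [simp, intro]:
      "\<lbrakk> a \<in> carrier R; x \<in> carrier M \<rbrakk> \<Longrightarrow> a \<odot>\<^bsub>M\<^esub> x \<in> carrier M"
    and smult_l_distr:
      "\<lbrakk> a \<in> carrier R; b \<in> carrier R; x \<in> carrier M \<rbrakk> \<Longrightarrow>
      (a \<oplus>\<^bsub>R\<^esub> b) \<odot>\<^bsub>M\<^esub> x = a \<odot>\<^bsub>M\<^esub> x \<oplus>\<^bsub>M\<^esub> b \<odot>\<^bsub>M\<^esub> x"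
    and smult_r_distr:
      "\<lbrakk> a \<in> carrier R; x \<in> carrier M; y \<in> carrier M \<rbrakk> \<Longrightarrow>
      a \<odot>\<^bsub>M\<^esub> (x \<oplus>\<^bsub>M\<^esub> y) = a \<odot>\<^bsub>M\<^esub> x \<oplus>\<^bsub>M\<^esub> a \<odot>\<^bsub>M\<^esub> y"
    and smult_assoc1:
      "\<lbrakk> a \<in> carrier R; b \<in> carrier R; x \<in> carrier M \<rbrakk> \<Longrightarrow>
      (a \<otimes>\<^bsub>R\<^esub> b) \<odot>\<^bsub>M\<^esub> x = a \<odot>\<^bsub>M\<^esub> (b \<odot>\<^bsub>M\<^esub> x)"
    and smult_one [simp]:
      "x \<in> carrier M \<Longrightarrow> \<one>\<^bsub>R\<^esub> \<odot>\<^bsub>M\<^esub> x = x"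

lemma module_iff_left_module: "module R M \<longleftrightarrow> cring R \<and> left_module R M"
  by (auto simp: module_def left_module_def module_axioms_def left_module_axioms_def
      intro: cring.axioms(1))

text \<open>A right \<open>R\<close>-module is a left module over the opposite ring: in its record,
  \<open>smult r x\<close> stands for \<open>x r\<close>.\<close>

definition opp_ring :: "('r, 'q) ring_scheme \<Rightarrow> ('r, 'q) ring_scheme" where
  "opp_ring R = R\<lparr>mult := \<lambda>x y. y \<otimes>\<^bsub>R\<^esub> x\<rparr>"

text \<open>Maps between modules are extensional functions (undefined outside the carrier), so that
  equality of maps is equality on the carrier.  Of the base ring, only the carrier enters the
  definition of a homomorphism; hence it applies verbatim to right modules.\<close>

definition add_hom :: "('m, 'q) ring_scheme \<Rightarrow> ('n, 's) ring_scheme \<Rightarrow> ('m \<Rightarrow> 'n) set" where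
  "add_hom M N = {f \<in> carrier M \<rightarrow>\<^sub>E carrier N.
     \<forall>x\<in>carrier M. \<forall>y\<in>carrier M. f (x \<oplus>\<^bsub>M\<^esub> y) = f x \<oplus>\<^bsub>N\<^esub> f y}"

definition mod_hom ::
  "('r, 'q) ring_scheme \<Rightarrow> ('r, 'm, 's) module_scheme \<Rightarrow> ('r, 'n, 't) module_scheme \<Rightarrow> ('m \<Rightarrow> 'n) set"
  where
  "mod_hom R M N = {f \<in> add_hom M N.
     \<forall>r\<in>carrier R. \<forall>x\<in>carrier M. f (r \<odot>\<^bsub>M\<^esub> x) = r \<odot>\<^bsub>N\<^esub> f x}"

definition mod_iso ::
  "('r, 'q) ring_scheme \<Rightarrow> ('r, 'm, 's) module_scheme \<Rightarrow> ('r, 'n, 't) module_scheme \<Rightarrow> bool" where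
  "mod_iso R M N \<longleftrightarrow> (\<exists>f\<in>mod_hom R M N. bij_betw f (carrier M) (carrier N))"

definition End_ring ::
  "('r, 'q) ring_scheme \<Rightarrow> ('r, 'm, 's) module_scheme \<Rightarrow> ('m \<Rightarrow> 'm) ring" where
  "End_ring R M = \<lparr>carrier = mod_hom R M M,
     mult = compose (carrier M), one = (\<lambda>x\<in>carrier M. x),
     zero = (\<lambda>x\<in>carrier M. \<zero>\<^bsub>M\<^esub>), add = (\<lambda>f g. \<lambda>x\<in>carrier M. f x \<oplus>\<^bsub>M\<^esub> g x)\<rparr>"

text \<open>\<open>End\<^sub>S(M)\<close> for a set \<open>S\<close> of endomaps of an abelian group \<open>M\<close>.\<close>

definition commutant :: "('m \<Rightarrow> 'm) set \<Rightarrow> ('m, 'q) ring_scheme \<Rightarrow> ('m \<Rightarrow> 'm) set" where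
  "commutant S M = {g \<in> add_hom M M. \<forall>f\<in>S. \<forall>x\<in>carrier M. g (f x) = f (g x)}"

definition Biend ::
  "('r, 'q) ring_scheme \<Rightarrow> ('r, 'm, 's) module_scheme \<Rightarrow> ('m \<Rightarrow> 'm) set" where
  "Biend R M = commutant (carrier (End_ring R M)) M"


section \<open>The finitely related complementation property\<close>

definition submodule_span ::
  "('r, 'q) ring_scheme \<Rightarrow> ('r, 'm, 's) module_scheme \<Rightarrow> 'm set \<Rightarrow> 'm set" where
  "submodule_span R M S = \<Inter>{N. submodule N R M \<and> S \<subseteq> N}"

definition fg_submodule ::
  "'m set \<Rightarrow> ('r, 'q) ring_scheme \<Rightarrow> ('r, 'm, 's) module_scheme \<Rightarrow> bool" where
  "fg_submodule K R M \<longleftrightarrow> (\<exists>S. finite S \<and> S \<subseteq> carrier M \<and> K = submodule_span R M S)"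

text \<open>The free left module \<open>R\<^sup>(\<^sup>X\<^sup>)\<close> of finitely supported families.\<close>

definition free_module :: "('r, 'q) ring_scheme \<Rightarrow> 'x set \<Rightarrow> ('r, 'x \<Rightarrow> 'r) module" where
  "free_module R X = \<lparr>carrier = {f \<in> X \<rightarrow>\<^sub>E carrier R. finite {x \<in> X. f x \<noteq> \<zero>\<^bsub>R\<^esub>}},
     mult = undefined, one = undefined,
     zero = (\<lambda>x\<in>X. \<zero>\<^bsub>R\<^esub>), add = (\<lambda>f g. \<lambda>x\<in>X. f x \<oplus>\<^bsub>R\<^esub> g x),
     smult = (\<lambda>r f. \<lambda>x\<in>X. r \<otimes>\<^bsub>R\<^esub> f x)\<rparr>"

text \<open>The scalar multiple of a coset \<open>A = K + x\<close> is \<open>K + r A = K + r x\<close>.\<close>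

definition quot_module :: "('r, 'm, 's) module_scheme \<Rightarrow> 'm set \<Rightarrow> ('r, 'm set) module" where
  "quot_module M K = \<lparr>carrier = a_rcosets\<^bsub>M\<^esub> K, mult = undefined, one = undefined,
     zero = K, add = set_add M, smult = (\<lambda>r A. K <+>\<^bsub>M\<^esub> ((\<lambda>x. r \<odot>\<^bsub>M\<^esub> x) ` A))\<rparr>"

text \<open>The type \<open>'x\<close> supplies the index sets of the free modules, and the type \<open>'w\<close> below the
  elements of the ambient module.  Both only restrict cardinalities of existentially quantified
  objects; a hypothesis \<open>FRCP TYPE('x) TYPE('w) R U\<close> in which \<open>'x\<close> and \<open>'w\<close> are type variables
  covers free modules of any rank and ambient modules of any size.\<close>

definition finitely_related ::
  "'x itself \<Rightarrow> ('r, 'q) ring_scheme \<Rightarrow> ('r, 'm, 's) module_scheme \<Rightarrow> bool" where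
  "finitely_related (_ :: 'x itself) R M \<longleftrightarrow>
     (\<exists>(X :: 'x set) K. fg_submodule K R (free_module R X) \<and>
        mod_iso R M (quot_module (free_module R X) K))"

definition direct_summand ::
  "'m set \<Rightarrow> ('r, 'q) ring_scheme \<Rightarrow> ('r, 'm, 's) module_scheme \<Rightarrow> bool" where
  "direct_summand D R M \<longleftrightarrow> submodule D R M \<and>
     (\<exists>E. submodule E R M \<and> D \<inter> E = {\<zero>\<^bsub>M\<^esub>} \<and> D <+>\<^bsub>M\<^esub> E = carrier M)"

definition FRCP ::
  "'x itself \<Rightarrow> 'w itself \<Rightarrow> ('r, 'q) ring_scheme \<Rightarrow> ('r, 'u, 's) module_scheme \<Rightarrow> bool" where
  "FRCP (tx :: 'x itself) (_ :: 'w itself) R U \<longleftrightarrow>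
     (\<exists>W :: ('r, 'w) module. left_module R W \<and>
        (\<exists>D. direct_summand D R W \<and> mod_iso R U (W\<lparr>carrier := D\<rparr>)) \<and>
        (\<forall>F. finite F \<and> F \<subseteq> carrier W \<longrightarrow>
           (\<exists>D. F \<subseteq> D \<and> direct_summand D R W \<and> finitely_related tx R (W\<lparr>carrier := D\<rparr>))))"


section \<open>Injective cogenerators and duals\<close>

definition central_subring :: "'r set \<Rightarrow> ('r, 'q) ring_scheme \<Rightarrow> bool" where
  "central_subring C R \<longleftrightarrow> subring C R \<and>
     (\<forall>c\<in>C. \<forall>r\<in>carrier R. c \<otimes>\<^bsub>R\<^esub> r = r \<otimes>\<^bsub>R\<^esub> c)"

text \<open>Quantification over all modules has to be restricted to a type \<open>'w\<close> of elements.
  Theorems \<open>injective_module_universe\<close> and \<open>cogenerator_universe\<close> below show that, with the type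
  \<open>'r set\<close> (where \<open>'r\<close> is the element type of the base ring), nothing is lost: the
  properties then hold for modules over every other type of elements as well.\<close>

definition injective_module ::
  "'w itself \<Rightarrow> ('r, 'q) ring_scheme \<Rightarrow> ('r, 'z, 's) module_scheme \<Rightarrow> bool" where
  "injective_module (_ :: 'w itself) K Z \<longleftrightarrow> module K Z \<and>
     (\<forall>(A :: ('r, 'w) module) (B :: ('r, 'w) module). module K A \<and> module K B \<longrightarrow>
        (\<forall>i\<in>mod_hom K A B. \<forall>f\<in>mod_hom K A Z. inj_on i (carrier A) \<longrightarrow>
           (\<exists>g\<in>mod_hom K B Z. compose (carrier A) g i = f)))"

definition cogenerator ::
  "'w itself \<Rightarrow> ('r, 'q) ring_scheme \<Rightarrow> ('r, 'z, 's) module_scheme \<Rightarrow> bool" where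
  "cogenerator (_ :: 'w itself) K Z \<longleftrightarrow> module K Z \<and>
     (\<forall>W :: ('r, 'w) module. module K W \<longrightarrow>
        (\<forall>w\<in>carrier W. w \<noteq> \<zero>\<^bsub>W\<^esub> \<longrightarrow> (\<exists>f\<in>mod_hom K W Z. f w \<noteq> \<zero>\<^bsub>Z\<^esub>)))"

text \<open>The bimodule \<open>U\<^sup>* = Hom\<^sub>K(U, Z)\<close> is given by two records over the same abelian group:
  in \<open>dual_right\<close> the scalars are those of \<open>U\<close>, acting from the right, and in \<open>dual_left\<close>
  they are the \<open>K\<close>-endomorphisms of \<open>Z\<close>, acting from the left.\<close>

definition dual_group ::
  "('r, 'q) ring_scheme \<Rightarrow> ('r, 'u, 's) module_scheme \<Rightarrow> ('r, 'z, 't) module_scheme \<Rightarrow> ('u \<Rightarrow> 'z) ring"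
  where
  "dual_group K U Z = \<lparr>carrier = mod_hom K U Z, mult = undefined, one = undefined,
     zero = (\<lambda>u\<in>carrier U. \<zero>\<^bsub>Z\<^esub>), add = (\<lambda>\<rho> \<sigma>. \<lambda>u\<in>carrier U. \<rho> u \<oplus>\<^bsub>Z\<^esub> \<sigma> u)\<rparr>"

definition dual_right ::
  "('r, 'q) ring_scheme \<Rightarrow> ('r, 'u, 's) module_scheme \<Rightarrow> ('r, 'z, 't) module_scheme \<Rightarrow>
   ('r, 'u \<Rightarrow> 'z) module" where
  "dual_right K U Z = ring.extend (dual_group K U Z)
     (module.fields (\<lambda>r \<rho>. \<lambda>u\<in>carrier U. \<rho> (r \<odot>\<^bsub>U\<^esub> u)))"

definition dual_left ::
  "('r, 'q) ring_scheme \<Rightarrow> ('r, 'u, 's) module_scheme \<Rightarrow> ('r, 'z, 't) module_scheme \<Rightarrow>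
   ('z \<Rightarrow> 'z, 'u \<Rightarrow> 'z) module" where
  "dual_left K U Z = ring.extend (dual_group K U Z)
     (module.fields (\<lambda>t \<rho>. compose (carrier U) t \<rho>))"

definition dual_bimodule_End ::
  "('r, 'q) ring_scheme \<Rightarrow> ('r, 'p) ring_scheme \<Rightarrow> ('r, 'u, 's) module_scheme \<Rightarrow>
   ('r, 'z, 't) module_scheme \<Rightarrow> (('u \<Rightarrow> 'z) \<Rightarrow> ('u \<Rightarrow> 'z)) set" where
  "dual_bimodule_End R K U Z =
     mod_hom (End_ring K Z) (dual_left K U Z) (dual_left K U Z) \<inter>
     mod_hom R (dual_right K U Z) (dual_right K U Z)"

definition adjoint ::
  "('r, 'q) ring_scheme \<Rightarrow> ('r, 'u, 's) module_scheme \<Rightarrow> ('r, 'z, 't) module_scheme \<Rightarrow>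
   ('u \<Rightarrow> 'u) \<Rightarrow> ('u \<Rightarrow> 'z) \<Rightarrow> 'u \<Rightarrow> 'z" where
  "adjoint K U Z g = (\<lambda>\<rho>\<in>mod_hom K U Z. compose (carrier U) \<rho> g)"

definition multiplications ::
  "('r, 'q) ring_scheme \<Rightarrow> ('r, 'z, 't) module_scheme \<Rightarrow> ('z \<Rightarrow> 'z) set" where
  "multiplications K Z = (\<lambda>c. \<lambda>z\<in>carrier Z. c \<odot>\<^bsub>Z\<^esub> z) ` carrier K"


section \<open>Well-formedness of the dual\<close>

lemma add_homD:
  assumes "f \<in> add_hom M N"
  shows "f \<in> extensional (carrier M)"
    and "x \<in> carrier M \<Longrightarrow> f x \<in> carrier N"
    and "x \<in> carrier M \<Longrightarrow> y \<in> carrier M \<Longrightarrow> f (x \<oplus>\<^bsub>M\<^esub> y) = f x \<oplus>\<^bsub>N\<^esub> f y"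
  using assms by (auto simp: add_hom_def PiE_def)

lemma mod_homD:
  assumes "f \<in> mod_hom R M N"
  shows "f \<in> extensional (carrier M)"
    and "x \<in> carrier M \<Longrightarrow> f x \<in> carrier N"
    and "x \<in> carrier M \<Longrightarrow> y \<in> carrier M \<Longrightarrow> f (x \<oplus>\<^bsub>M\<^esub> y) = f x \<oplus>\<^bsub>N\<^esub> f y"
    and "r \<in> carrier R \<Longrightarrow> x \<in> carrier M \<Longrightarrow> f (r \<odot>\<^bsub>M\<^esub> x) = r \<odot>\<^bsub>N\<^esub> f x"
  using assms by (auto simp: mod_hom_def add_hom_def PiE_def)

lemma mod_homI:
  assumes "f \<in> extensional (carrier M)"
    and "\<And>x. x \<in> carrier M \<Longrightarrow> f x \<in> carrier N"
    and "\<And>x y. x \<in> carrier M \<Longrightarrow> y \<in> carrier M \<Longrightarrow> f (x \<oplus>\<^bsub>M\<^esub> y) = f x \<oplus>\<^bsub>N\<^esub> f y"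
    and "\<And>r x. r \<in> carrier R \<Longrightarrow> x \<in> carrier M \<Longrightarrow> f (r \<odot>\<^bsub>M\<^esub> x) = r \<odot>\<^bsub>N\<^esub> f x"
  shows "f \<in> mod_hom R M N"
  using assms by (auto simp: mod_hom_def add_hom_def PiE_def)

lemma mod_hom_compose:
  assumes "module R M" "f \<in> mod_hom R M N" "g \<in> mod_hom R N P"
  shows "compose (carrier M) g f \<in> mod_hom R M P"
proof -
  interpret module R M by fact
  show ?thesis
    by (rule mod_homI)
      (simp_all add: compose_def mod_homD[OF assms(2)] mod_homD[OF assms(3)])
qed

lemma dual_simps:
  "carrier (dual_right K U Z) = mod_hom K U Z"
  "add (dual_right K U Z) = (\<lambda>\<rho> \<sigma>. \<lambda>u\<in>carrier U. \<rho> u \<oplus>\<^bsub>Z\<^esub> \<sigma> u)"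
  "zero (dual_right K U Z) = (\<lambda>u\<in>carrier U. \<zero>\<^bsub>Z\<^esub>)"
  "smult (dual_right K U Z) = (\<lambda>r \<rho>. \<lambda>u\<in>carrier U. \<rho> (r \<odot>\<^bsub>U\<^esub> u))"
  "carrier (dual_left K U Z) = mod_hom K U Z"
  "add (dual_left K U Z) = (\<lambda>\<rho> \<sigma>. \<lambda>u\<in>carrier U. \<rho> u \<oplus>\<^bsub>Z\<^esub> \<sigma> u)"
  "zero (dual_left K U Z) = (\<lambda>u\<in>carrier U. \<zero>\<^bsub>Z\<^esub>)"
  "smult (dual_left K U Z) = (\<lambda>t \<rho>. compose (carrier U) t \<rho>)"
  by (simp_all add: dual_right_def dual_left_def dual_group_def
      ring.extend_def module.fields_def)

lemma (in module) hom_add: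
  assumes U: "module R U" and f: "f \<in> mod_hom R U M" and g: "g \<in> mod_hom R U M"
  shows "(\<lambda>u\<in>carrier U. f u \<oplus>\<^bsub>M\<^esub> g u) \<in> mod_hom R U M"
proof -
  interpret U: module R U by fact
  show ?thesis
    by (rule mod_homI)
      (auto simp: mod_homD[OF f] mod_homD[OF g] M.a_ac smult_r_distr)
qed

lemma (in module) hom_abelian_group:
  fixes G (structure)
  assumes U: "module R U"
    and G: "carrier G = mod_hom R U M" "add G = (\<lambda>f g. \<lambda>u\<in>carrier U. f u \<oplus>\<^bsub>M\<^esub> g u)"
      "zero G = (\<lambda>u\<in>carrier U. \<zero>\<^bsub>M\<^esub>)"
  shows "abelian_group G"
proof -
  interpret U: module R U by fact
  note D = mod_homD[of _ R U M]
  show ?thesis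
  proof (rule abelian_groupI)
    fix f g assume f: "f \<in> carrier G" and g: "g \<in> carrier G"
    show "f \<oplus>\<^bsub>G\<^esub> g \<in> carrier G" using hom_add[OF U] f g by (simp add: G)
    show "f \<oplus>\<^bsub>G\<^esub> g = g \<oplus>\<^bsub>G\<^esub> f" using f g by (auto simp: G D M.a_comm)
    fix h assume h: "h \<in> carrier G"
    show "(f \<oplus>\<^bsub>G\<^esub> g) \<oplus>\<^bsub>G\<^esub> h = f \<oplus>\<^bsub>G\<^esub> (g \<oplus>\<^bsub>G\<^esub> h)" using f g h by (auto simp: G D M.a_assoc)
  next
    show "\<zero>\<^bsub>G\<^esub> \<in> carrier G"
      by (simp only: G) (rule mod_homI, auto)
  next
    fix f assume f: "f \<in> carrier G"
    show "\<zero>\<^bsub>G\<^esub> \<oplus>\<^bsub>G\<^esub> f = f"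
      using f by (intro extensionalityI[of _ "carrier U"]) (auto simp: G D)
    have "(\<lambda>u\<in>carrier U. \<ominus>\<^bsub>M\<^esub> f u) \<in> mod_hom R U M"
      using f by (intro mod_homI) (auto simp: G D M.minus_add smult_r_minus M.a_comm)
    moreover have "(\<lambda>u\<in>carrier U. \<ominus>\<^bsub>M\<^esub> f u) \<oplus>\<^bsub>G\<^esub> f = \<zero>\<^bsub>G\<^esub>"
      using f by (auto simp: G D M.l_neg)
    ultimately show "\<exists>g\<in>carrier G. g \<oplus>\<^bsub>G\<^esub> f = \<zero>\<^bsub>G\<^esub>" unfolding G(1) by blast
  qed
qed

lemma End_ring_ring:
  assumes "module K Z" shows "ring (End_ring K Z)"
proof -
  interpret Z: module K Z by fact
  note D = mod_homD[of _ K Z Z]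
  show ?thesis
  proof (rule ringI)
    show "abelian_group (End_ring K Z)"
      by (rule Z.hom_abelian_group[OF assms]) (auto simp: End_ring_def)
    have "(\<lambda>x\<in>carrier Z. x) \<in> mod_hom K Z Z" by (rule mod_homI) auto
    then show "Group.monoid (End_ring K Z)"
      by (intro monoidI)
        (auto simp: End_ring_def mod_hom_compose[OF assms] D compose_assoc
          intro!: extensionalityI[of _ "carrier Z"], auto simp: compose_def D)
  qed (auto simp: End_ring_def D compose_def)
qed

lemma restricted_module:
  assumes "left_module R U" "central_subring C R"
  shows "module (R\<lparr>carrier := C\<rparr>) U"
proof -
  interpret U: left_module R U by fact
  have C: "subring C R" "C \<subseteq> carrier R" "\<And>c r. c \<in> C \<Longrightarrow> r \<in> carrier R \<Longrightarrow> c \<otimes>\<^bsub>R\<^esub> r = r \<otimes>\<^bsub>R\<^esub> c"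
    using assms(2) subringE(1)[of C R] by (auto simp: central_subring_def)
  show ?thesis
  proof (rule moduleI)
    have "subcring C R" using C by (intro U.subcringI) auto
    then show "cring (R\<lparr>carrier := C\<rparr>)" using U.subcring_iff C(2) by blast
    show "abelian_group U" by (rule U.M.abelian_group_axioms)
  qed (use C(2) in \<open>auto simp: U.smult_l_distr U.smult_r_distr U.smult_assoc1 subset_iff\<close>)
qed

lemma dual_left_module:
  assumes "module K U" "module K Z"
  shows "left_module (End_ring K Z) (dual_left K U Z)"
proof -
  interpret U: module K U by fact
  interpret Z: module K Z by fact
  note D = mod_homD[of _ K U Z] mod_homD[of _ K Z Z]
  show ?thesis
  proof (intro left_module.intro left_module_axioms.intro)
    show "ring (End_ring K Z)" by (rule End_ring_ring[OF assms(2)])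
    show "abelian_group (dual_left K U Z)"
      by (rule Z.hom_abelian_group[OF assms(1)]) (auto simp: dual_simps)
  next
    fix x assume "x \<in> carrier (dual_left K U Z)"
    then show "\<one>\<^bsub>End_ring K Z\<^esub> \<odot>\<^bsub>dual_left K U Z\<^esub> x = x"
      by (intro extensionalityI[of _ "carrier U"])
        (auto simp: dual_simps End_ring_def D compose_def)
  qed (auto simp: dual_simps End_ring_def mod_hom_compose[OF assms(1)] D compose_def
      intro: mod_hom_compose[OF assms(1), unfolded compose_def])
qed

lemma dual_right_module:
  assumes "left_module R U" "central_subring C R" "module (R\<lparr>carrier := C\<rparr>) Z"
  shows "left_module (opp_ring R) (dual_right (R\<lparr>carrier := C\<rparr>) U Z)"
proof -
  let ?K = "R\<lparr>carrier := C\<rparr>"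
  interpret U: left_module R U by fact
  interpret Z: module ?K Z by fact
  have UK: "module ?K U" by (rule restricted_module[OF assms(1,2)])
  have C: "C \<subseteq> carrier R" "\<And>c r. c \<in> C \<Longrightarrow> r \<in> carrier R \<Longrightarrow> c \<otimes>\<^bsub>R\<^esub> r = r \<otimes>\<^bsub>R\<^esub> c"
    using assms(2) subringE(1)[of C R] by (auto simp: central_subring_def)
  note D = mod_homD(1-3)[of _ ?K U Z] mod_homD(4)[of _ ?K U Z, simplified]
  show ?thesis
  proof (intro left_module.intro left_module_axioms.intro)
    show "abelian_group (dual_right ?K U Z)"
      by (rule Z.hom_abelian_group[OF UK]) (auto simp: dual_simps)
    have "abelian_group (opp_ring R)"
      by (rule abelian_groupI)
        (auto simp: opp_ring_def U.R.a_ac intro: bexI[of _ "\<ominus>\<^bsub>R\<^esub> x" for x] U.R.l_neg)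
    then show "ring (opp_ring R)"
      by (intro ringI monoidI)
        (auto simp: opp_ring_def U.R.m_assoc U.R.l_distr U.R.r_distr)
  next
    fix r x assume r: "r \<in> carrier (opp_ring R)" and x: "x \<in> carrier (dual_right ?K U Z)"
    have *: "r \<odot>\<^bsub>U\<^esub> (c \<odot>\<^bsub>U\<^esub> u) = c \<odot>\<^bsub>U\<^esub> (r \<odot>\<^bsub>U\<^esub> u)" if "c \<in> C" "u \<in> carrier U" for c u
      using that r C(1) C(2)[of c r]
      by (auto simp: opp_ring_def U.smult_assoc1[symmetric] subset_iff)
    show "r \<odot>\<^bsub>dual_right ?K U Z\<^esub> x \<in> carrier (dual_right ?K U Z)"
      unfolding dual_simps
    proof (rule mod_homI)
      fix c u assume "c \<in> carrier ?K" "u \<in> carrier U"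
      then show "(\<lambda>u\<in>carrier U. x (r \<odot>\<^bsub>U\<^esub> u)) (c \<odot>\<^bsub>U\<^esub> u)
          = c \<odot>\<^bsub>Z\<^esub> (\<lambda>u\<in>carrier U. x (r \<odot>\<^bsub>U\<^esub> u)) u"
        using r x C(1) * by (auto simp: opp_ring_def dual_simps D subset_iff)
    qed (use r x in \<open>auto simp: opp_ring_def dual_simps D U.smult_r_distr\<close>)
  next
    fix x assume "x \<in> carrier (dual_right ?K U Z)"
    then show "\<one>\<^bsub>opp_ring R\<^esub> \<odot>\<^bsub>dual_right ?K U Z\<^esub> x = x"
      by (intro extensionalityI[of _ "carrier U"])
        (auto simp: dual_simps opp_ring_def D)
  qed (auto simp: dual_simps opp_ring_def D U.smult_l_distr U.smult_r_distr U.smult_assoc1)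
qed


section \<open>Independence of the universe of test modules\<close>

definition push_module :: "('m \<Rightarrow> 'n) \<Rightarrow> ('r, 'm, 's) module_scheme \<Rightarrow> ('r, 'n) module" where
  "push_module e M = (let d = the_inv_into (carrier M) e in
     \<lparr>carrier = e ` carrier M, mult = undefined, one = undefined,
      zero = e \<zero>\<^bsub>M\<^esub>, add = (\<lambda>x y. e (d x \<oplus>\<^bsub>M\<^esub> d y)), smult = (\<lambda>r x. e (r \<odot>\<^bsub>M\<^esub> d x))\<rparr>)"

lemma push_module:
  assumes "module K M" and e: "inj_on e (carrier M)"
  shows "module K (push_module e M)"
    and "restrict e (carrier M) \<in> mod_hom K M (push_module e M)"
proof -
  interpret module K M by fact
  note [simp] = the_inv_into_f_f[OF e]
  have s: "carrier (push_module e M) = e ` carrier M" "zero (push_module e M) = e \<zero>\<^bsub>M\<^esub>"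
    "x \<in> carrier M \<Longrightarrow> y \<in> carrier M \<Longrightarrow> e x \<oplus>\<^bsub>push_module e M\<^esub> e y = e (x \<oplus>\<^bsub>M\<^esub> y)"
    "x \<in> carrier M \<Longrightarrow> r \<odot>\<^bsub>push_module e M\<^esub> e x = e (r \<odot>\<^bsub>M\<^esub> x)" for x y r
    by (auto simp: push_module_def Let_def)
  have ag: "abelian_group (push_module e M)"
  proof (rule abelian_groupI)
    fix x assume "x \<in> carrier (push_module e M)"
    then obtain a where a: "a \<in> carrier M" "x = e a" by (auto simp: s)
    then have "e (\<ominus>\<^bsub>M\<^esub> a) \<oplus>\<^bsub>push_module e M\<^esub> x = \<zero>\<^bsub>push_module e M\<^esub>"
      by (simp add: s M.l_neg)
    then show "\<exists>y\<in>carrier (push_module e M). y \<oplus>\<^bsub>push_module e M\<^esub> x = \<zero>\<^bsub>push_module e M\<^esub>"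
      using a by (auto simp: s)
  qed (auto simp: s M.a_ac)
  show "module K (push_module e M)"
    by (rule moduleI) (auto simp: ag R.is_cring s smult_l_distr smult_r_distr smult_assoc1)
  show "restrict e (carrier M) \<in> mod_hom K M (push_module e M)"
    by (rule mod_homI) (auto simp: s)
qed

lemma (in module) hom_zero_neg:
  assumes N: "module R N" and f: "f \<in> mod_hom R M N"
  shows "f \<zero>\<^bsub>M\<^esub> = \<zero>\<^bsub>N\<^esub>" and "x \<in> carrier M \<Longrightarrow> f (\<ominus>\<^bsub>M\<^esub> x) = \<ominus>\<^bsub>N\<^esub> f x"
proof -
  interpret N: module R N by fact
  show 0: "f \<zero>\<^bsub>M\<^esub> = \<zero>\<^bsub>N\<^esub>"
    using mod_homD(4)[OF f, of "\<zero>\<^bsub>R\<^esub>" "\<zero>\<^bsub>M\<^esub>"] mod_homD(2)[OF f] by simp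
  assume x: "x \<in> carrier M"
  then have "f (\<ominus>\<^bsub>M\<^esub> x) \<oplus>\<^bsub>N\<^esub> f x = \<zero>\<^bsub>N\<^esub>"
    using mod_homD(3)[OF f, of "\<ominus>\<^bsub>M\<^esub> x" x] 0 by (simp add: M.l_neg)
  then show "f (\<ominus>\<^bsub>M\<^esub> x) = \<ominus>\<^bsub>N\<^esub> f x"
    using x mod_homD(2)[OF f] by (metis N.M.minus_equality M.a_inv_closed)
qed

lemma injective_module_bigger_universe:
  fixes K :: "('r, 'q) ring_scheme" and e :: "'w \<Rightarrow> 'v"
  assumes Z: "injective_module TYPE('v) K Z" and e: "inj e"
  shows "injective_module TYPE('w) K Z"
  unfolding injective_module_def
proof (intro conjI allI impI ballI)
  show "module K Z" using Z by (simp add: injective_module_def)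
next
  fix A B :: "('r, 'w) module" and i f
  assume AB: "module K A \<and> module K B" and i: "i \<in> mod_hom K A B" and f: "f \<in> mod_hom K A Z"
    and inj: "inj_on i (carrier A)"
  have A: "module K A" and B: "module K B" using AB by auto
  interpret A: module K A by fact
  interpret B: module K B by fact
  have eA: "inj_on e (carrier A)" and eB: "inj_on e (carrier B)"
    using e by (auto intro: inj_on_subset)
  define d where "d = inv_into UNIV e"
  have d[simp]: "d (e x) = x" for x by (simp add: d_def e)
  have s: "carrier (push_module e M) = e ` carrier M"
    "x \<in> carrier M \<Longrightarrow> y \<in> carrier M \<Longrightarrow> e x \<oplus>\<^bsub>push_module e M\<^esub> e y = e (x \<oplus>\<^bsub>M\<^esub> y)"
    "x \<in> carrier M \<Longrightarrow> r \<odot>\<^bsub>push_module e M\<^esub> e x = e (r \<odot>\<^bsub>M\<^esub> x)"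
    for M :: "('r, 'w) module" and x y r
    using e by (auto simp: push_module_def Let_def the_inv_into_f_f[OF inj_on_subset[OF e]])
  let ?A = "push_module e A" and ?B = "push_module e B"
  let ?i = "\<lambda>x\<in>carrier ?A. e (i (d x))" and ?f = "\<lambda>x\<in>carrier ?A. f (d x)"
  have "?i \<in> mod_hom K ?A ?B"
    by (rule mod_homI) (auto simp: s mod_homD[OF i] inj_eq[OF e])
  moreover have "?f \<in> mod_hom K ?A Z"
    by (rule mod_homI) (auto simp: s mod_homD[OF f] inj_eq[OF e])
  moreover have "inj_on ?i (carrier ?A)"
    using inj e by (auto simp: inj_on_def s dest: injD)
  ultimately obtain g where g: "g \<in> mod_hom K ?B Z" "compose (carrier ?A) g ?i = ?f"
    using Z push_module(1)[OF A eA] push_module(1)[OF B eB]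
    unfolding injective_module_def by metis
  have gi: "g (e (i x)) = f x" if "x \<in> carrier A" for x
    using fun_cong[OF g(2), of "e x"] that by (simp add: compose_def s)
  let ?g = "compose (carrier B) g (restrict e (carrier B))"
  have "?g \<in> mod_hom K B Z"
    by (rule mod_hom_compose[OF B push_module(2)[OF B eB] g(1)])
  moreover have "compose (carrier A) ?g i = f"
    by (rule extensionalityI[of _ "carrier A"])
      (use gi mod_homD[OF i] mod_homD[OF f] in \<open>auto simp: compose_def\<close>)
  ultimately show "\<exists>g\<in>mod_hom K B Z. compose (carrier A) g i = f" by blast
qed

text \<open>Baer's criterion.\<close>

theorem injective_module_universe:
  fixes K :: "('r, 'q) ring_scheme"
  assumes "injective_module TYPE('r set) K Z"
  shows "injective_module TYPE('w) K Z"
  unfolding injective_module_def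
proof (intro conjI allI impI ballI)
  have inj_r: "injective_module TYPE('r) K Z"
    by (rule injective_module_bigger_universe[OF assms, of "\<lambda>x. {x}"]) (auto simp: inj_on_def)
  show Z: "module K Z" using assms by (simp add: injective_module_def)
  interpret Z: module K Z by fact
  fix A B :: "('r, 'w) module" and i f
  assume AB: "module K A \<and> module K B" and i: "i \<in> mod_hom K A B" and f: "f \<in> mod_hom K A Z"
    and inj: "inj_on i (carrier A)"
  have A: "module K A" and B: "module K B" using AB by auto
  interpret A: module K A by fact
  interpret B: module K B by fact
  let ?G0 = "(\<lambda>a. (i a, f a)) ` carrier A"
  define good where "good = (\<lambda>G. G \<subseteq> carrier B \<times> carrier Z \<and> ?G0 \<subseteq> G \<and>
    (\<forall>x y x' y'. (x, y) \<in> G \<longrightarrow> (x', y') \<in> G \<longrightarrow> (x \<oplus>\<^bsub>B\<^esub> x', y \<oplus>\<^bsub>Z\<^esub> y') \<in> G) \<and>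
    (\<forall>r x y. r \<in> carrier K \<longrightarrow> (x, y) \<in> G \<longrightarrow> (r \<odot>\<^bsub>B\<^esub> x, r \<odot>\<^bsub>Z\<^esub> y) \<in> G) \<and>
    (\<forall>y. (\<zero>\<^bsub>B\<^esub>, y) \<in> G \<longrightarrow> y = \<zero>\<^bsub>Z\<^esub>))"
  have iz: "i \<zero>\<^bsub>A\<^esub> = \<zero>\<^bsub>B\<^esub>" "f \<zero>\<^bsub>A\<^esub> = \<zero>\<^bsub>Z\<^esub>"
    using A.hom_zero_neg(1)[OF B i] A.hom_zero_neg(1)[OF Z f] by auto
  have good0: "good ?G0"
    unfolding good_def
  proof (intro conjI allI impI)
    fix y assume "(\<zero>\<^bsub>B\<^esub>, y) \<in> ?G0"
    then obtain a where a: "a \<in> carrier A" "i a = i \<zero>\<^bsub>A\<^esub>" "y = f a" using iz by auto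
    then have "a = \<zero>\<^bsub>A\<^esub>" using inj by (auto dest: inj_onD)
    then show "y = \<zero>\<^bsub>Z\<^esub>" using a iz by simp
  next
    fix x y x' y' assume "(x, y) \<in> ?G0" "(x', y') \<in> ?G0"
    then obtain a a' where "a \<in> carrier A" "a' \<in> carrier A" "x = i a" "y = f a" "x' = i a'" "y' = f a'"
      by auto
    then show "(x \<oplus>\<^bsub>B\<^esub> x', y \<oplus>\<^bsub>Z\<^esub> y') \<in> ?G0"
      by (intro image_eqI[of _ _ "a \<oplus>\<^bsub>A\<^esub> a'"]) (simp_all add: mod_homD[OF i] mod_homD[OF f])
  next
    fix r x y assume "r \<in> carrier K" "(x, y) \<in> ?G0"
    then obtain a where "a \<in> carrier A" "x = i a" "y = f a" by auto
    then show "(r \<odot>\<^bsub>B\<^esub> x, r \<odot>\<^bsub>Z\<^esub> y) \<in> ?G0"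
      using \<open>r \<in> carrier K\<close>
      by (intro image_eqI[of _ _ "r \<odot>\<^bsub>A\<^esub> a"]) (simp_all add: mod_homD[OF i] mod_homD[OF f])
  qed (auto simp: mod_homD[OF i] mod_homD[OF f])
  have "\<exists>G\<in>Collect good. \<forall>X\<in>Collect good. G \<subseteq> X \<longrightarrow> X = G"
  proof (rule subset_Zorn_nonempty)
    show "Collect good \<noteq> {}" using good0 by auto
    fix \<C> assume ne: "\<C> \<noteq> {}" and ch: "subset.chain (Collect good) \<C>"
    have gd: "good G" if "G \<in> \<C>" for G using ch that by (auto simp: subset.chain_def)
    have two: "\<exists>G\<in>\<C>. p \<in> G \<and> p' \<in> G" if "p \<in> \<Union>\<C>" "p' \<in> \<Union>\<C>" for p p'
    proof -
      from that obtain G H where GH: "G \<in> \<C>" "p \<in> G" "H \<in> \<C>" "p' \<in> H" by blast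
      then have "G \<subseteq> H \<or> H \<subseteq> G" using ch by (simp add: subset_chain_def)
      then show ?thesis using GH by blast
    qed
    have "good (\<Union>\<C>)"
      unfolding good_def
    proof (intro conjI allI impI)
      have "G \<subseteq> carrier B \<times> carrier Z" if "G \<in> \<C>" for G
        using gd[OF that] by (simp add: good_def)
      then show "\<Union>\<C> \<subseteq> carrier B \<times> carrier Z" by (rule Union_least)
      obtain G where "G \<in> \<C>" using ne by blast
      then show "?G0 \<subseteq> \<Union>\<C>" using gd[of G] unfolding good_def by blast
    next
      fix x y x' y' assume "(x, y) \<in> \<Union>\<C>" "(x', y') \<in> \<Union>\<C>"
      then obtain G where G: "G \<in> \<C>" "(x, y) \<in> G" "(x', y') \<in> G" using two by blast
      then have "(x \<oplus>\<^bsub>B\<^esub> x', y \<oplus>\<^bsub>Z\<^esub> y') \<in> G" using gd[OF G(1)] by (simp add: good_def)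
      then show "(x \<oplus>\<^bsub>B\<^esub> x', y \<oplus>\<^bsub>Z\<^esub> y') \<in> \<Union>\<C>" using G(1) by blast
    next
      fix r x y assume r: "r \<in> carrier K" and "(x, y) \<in> \<Union>\<C>"
      then obtain G where G: "G \<in> \<C>" "(x, y) \<in> G" by blast
      then have "(r \<odot>\<^bsub>B\<^esub> x, r \<odot>\<^bsub>Z\<^esub> y) \<in> G" using gd[OF G(1)] r by (simp add: good_def)
      then show "(r \<odot>\<^bsub>B\<^esub> x, r \<odot>\<^bsub>Z\<^esub> y) \<in> \<Union>\<C>" using G(1) by blast
    next
      fix y assume "(\<zero>\<^bsub>B\<^esub>, y) \<in> \<Union>\<C>"
      then show "y = \<zero>\<^bsub>Z\<^esub>" using gd unfolding good_def by blast
    qed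
    then show "\<Union>\<C> \<in> Collect good" by simp
  qed
  then obtain G where G: "good G" and max: "\<And>X. good X \<Longrightarrow> G \<subseteq> X \<Longrightarrow> X = G" by auto
  have Gsub: "(x, y) \<in> G \<Longrightarrow> x \<in> carrier B" "(x, y) \<in> G \<Longrightarrow> y \<in> carrier Z"
    and G0: "a \<in> carrier A \<Longrightarrow> (i a, f a) \<in> G"
    and Gadd: "(x, y) \<in> G \<Longrightarrow> (x', y') \<in> G \<Longrightarrow> (x \<oplus>\<^bsub>B\<^esub> x', y \<oplus>\<^bsub>Z\<^esub> y') \<in> G"
    and Gsm: "r \<in> carrier K \<Longrightarrow> (x, y) \<in> G \<Longrightarrow> (r \<odot>\<^bsub>B\<^esub> x, r \<odot>\<^bsub>Z\<^esub> y) \<in> G"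
    and Gz: "(\<zero>\<^bsub>B\<^esub>, y) \<in> G \<Longrightarrow> y = \<zero>\<^bsub>Z\<^esub>" for x y x' y' r a
    using G by (auto simp: good_def)
  have Gzz: "(\<zero>\<^bsub>B\<^esub>, \<zero>\<^bsub>Z\<^esub>) \<in> G" using G0[of "\<zero>\<^bsub>A\<^esub>"] iz by simp
  have Gneg: "(\<ominus>\<^bsub>B\<^esub> x, \<ominus>\<^bsub>Z\<^esub> y) \<in> G" if "(x, y) \<in> G" for x y
    using Gsm[of "\<ominus>\<^bsub>K\<^esub> \<one>\<^bsub>K\<^esub>", OF _ that] Gsub[OF that]
    by (simp add: B.smult_l_minus Z.smult_l_minus)
  have Guniq: "y = y'" if "(x, y) \<in> G" "(x, y') \<in> G" for x y y'
  proof -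
    have "(\<zero>\<^bsub>B\<^esub>, y \<oplus>\<^bsub>Z\<^esub> \<ominus>\<^bsub>Z\<^esub> y') \<in> G"
      using Gadd[OF that(1) Gneg[OF that(2)]] Gsub[OF that(1)] by (simp add: B.M.r_neg)
    from Gz[OF this] show ?thesis
      using Gsub[OF that(1)] Gsub[OF that(2)] Z.M.minus_equality[of y "\<ominus>\<^bsub>Z\<^esub> y'"] by simp
  qed
  have dom: "\<exists>y. (b, y) \<in> G" if b: "b \<in> carrier B" for b
  proof -
    define I where "I = {r \<in> carrier K. \<exists>y. (r \<odot>\<^bsub>B\<^esub> b, y) \<in> G}"
    define h where "h = (\<lambda>r\<in>I. THE y. (r \<odot>\<^bsub>B\<^esub> b, y) \<in> G)"
    have h: "(r \<odot>\<^bsub>B\<^esub> b, h r) \<in> G" if "r \<in> I" for r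
    proof -
      have "\<exists>!y. (r \<odot>\<^bsub>B\<^esub> b, y) \<in> G" using that Guniq by (auto simp: I_def)
      from theI'[OF this] show ?thesis using that by (simp add: h_def)
    qed
    let ?K = "\<lparr>carrier = carrier K, mult = undefined, one = undefined, zero = \<zero>\<^bsub>K\<^esub>, add = add K,
      smult = mult K\<rparr> :: ('r, 'r) module"
    let ?I = "?K\<lparr>carrier := I\<rparr>"
    have K: "module K ?K"
    proof (rule moduleI)
      show "abelian_group ?K"
        by (rule abelian_groupI)
          (auto simp: Z.R.a_ac intro: bexI[of _ "\<ominus>\<^bsub>K\<^esub> x" for x] Z.R.l_neg)
    qed (auto simp: Z.R.is_cring Z.R.l_distr Z.R.r_distr Z.R.m_assoc)
    interpret KK: module K ?K by (rule K)
    have Ineg: "\<ominus>\<^bsub>?K\<^esub> r = \<ominus>\<^bsub>K\<^esub> r" for r by (simp add: a_inv_def m_inv_def)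
    have Iadd: "r \<oplus>\<^bsub>K\<^esub> r' \<in> I" if "r \<in> I" "r' \<in> I" for r r'
      using that b Gadd by (fastforce simp: I_def B.smult_l_distr)
    have Ism: "r \<otimes>\<^bsub>K\<^esub> r' \<in> I" if "r \<in> carrier K" "r' \<in> I" for r r'
      using that b Gsm by (fastforce simp: I_def B.smult_assoc1)
    have subI: "submodule I K ?K"
    proof (rule KK.submoduleI)
      show "I \<subseteq> carrier ?K" by (auto simp: I_def)
      show "\<zero>\<^bsub>?K\<^esub> \<in> I" using Gzz b by (auto simp: I_def)
      show "\<ominus>\<^bsub>?K\<^esub> r \<in> I" if "r \<in> I" for r
        using that b Gneg by (fastforce simp: I_def Ineg B.smult_l_minus)
    qed (use Iadd Ism in auto)
    have I: "module K ?I" by (rule submodule.submodule_is_module[OF subI K])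
    have "restrict id I \<in> mod_hom K ?I ?K"
      by (rule mod_homI) (use Iadd Ism in \<open>auto simp: I_def\<close>)
    moreover have "h \<in> mod_hom K ?I Z"
    proof (rule mod_homI)
      show "h \<in> extensional (carrier ?I)" by (simp add: h_def)
    next
      fix r assume "r \<in> carrier ?I" then show "h r \<in> carrier Z" using Gsub(2)[OF h] by simp
    next
      fix r r' assume "r \<in> carrier ?I" "r' \<in> carrier ?I"
      then have r: "r \<in> I" "r' \<in> I" "r \<in> carrier K" "r' \<in> carrier K" by (auto simp: I_def)
      show "h (r \<oplus>\<^bsub>?I\<^esub> r') = h r \<oplus>\<^bsub>Z\<^esub> h r'"
        using h[OF Iadd[OF r(1,2)]] Gadd[OF h[OF r(1)] h[OF r(2)]] r b
        by (auto simp: B.smult_l_distr intro: Guniq)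
    next
      fix r r' assume "r \<in> carrier K" "r' \<in> carrier ?I"
      then have r: "r \<in> carrier K" "r' \<in> I" "r' \<in> carrier K" by (auto simp: I_def)
      show "h (r \<odot>\<^bsub>?I\<^esub> r') = r \<odot>\<^bsub>Z\<^esub> h r'"
        using h[OF Ism[OF r(1,2)]] Gsm[OF r(1) h[OF r(2)]] r b
        by (auto simp: B.smult_assoc1 intro: Guniq)
    qed
    moreover have "inj_on (restrict id I) (carrier ?I)" by (auto simp: inj_on_def)
    ultimately obtain g where g: "g \<in> mod_hom K ?K Z" "compose (carrier ?I) g (restrict id I) = h"
      using inj_r I K unfolding injective_module_def by metis
    define z where "z = g \<one>\<^bsub>K\<^esub>"
    have z: "z \<in> carrier Z" using mod_homD(2)[OF g(1)] by (simp add: z_def)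
    have hz: "h r = r \<odot>\<^bsub>Z\<^esub> z" if "r \<in> I" for r
      using fun_cong[OF g(2), of r] mod_homD(4)[OF g(1), of r "\<one>\<^bsub>K\<^esub>"] that
      by (simp add: compose_def z_def I_def)
    define G' where "G' = {(x \<oplus>\<^bsub>B\<^esub> r \<odot>\<^bsub>B\<^esub> b, y \<oplus>\<^bsub>Z\<^esub> r \<odot>\<^bsub>Z\<^esub> z) | x y r. (x, y) \<in> G \<and> r \<in> carrier K}"
    have G'I: "(x \<oplus>\<^bsub>B\<^esub> r \<odot>\<^bsub>B\<^esub> b, y \<oplus>\<^bsub>Z\<^esub> r \<odot>\<^bsub>Z\<^esub> z) \<in> G'" if "(x, y) \<in> G" "r \<in> carrier K" for x y r
      using that by (auto simp: G'_def)
    have GG': "G \<subseteq> G'"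
    proof
      fix p assume p: "p \<in> G"
      then show "p \<in> G'"
        using G'I[of "fst p" "snd p" "\<zero>\<^bsub>K\<^esub>"] Gsub[of "fst p" "snd p"] b z by simp
    qed
    have "good G'"
      unfolding good_def
    proof (intro conjI allI impI)
      show "G' \<subseteq> carrier B \<times> carrier Z" using Gsub b z by (auto simp: G'_def)
      show "?G0 \<subseteq> G'" using GG' G0 by auto
    next
      fix x y x' y' assume "(x, y) \<in> G'" "(x', y') \<in> G'"
      then obtain u v r u' v' r' where
        *: "(u, v) \<in> G" "r \<in> carrier K" "x = u \<oplus>\<^bsub>B\<^esub> r \<odot>\<^bsub>B\<^esub> b" "y = v \<oplus>\<^bsub>Z\<^esub> r \<odot>\<^bsub>Z\<^esub> z"
        "(u', v') \<in> G" "r' \<in> carrier K" "x' = u' \<oplus>\<^bsub>B\<^esub> r' \<odot>\<^bsub>B\<^esub> b" "y' = v' \<oplus>\<^bsub>Z\<^esub> r' \<odot>\<^bsub>Z\<^esub> z"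
        unfolding G'_def by blast
      then show "(x \<oplus>\<^bsub>B\<^esub> x', y \<oplus>\<^bsub>Z\<^esub> y') \<in> G'"
        using G'I[OF Gadd[OF *(1,5)], of "r \<oplus>\<^bsub>K\<^esub> r'"] Gsub[OF *(1)] Gsub[OF *(5)] b z
        by (simp add: B.smult_l_distr Z.smult_l_distr B.M.a_ac Z.M.a_ac)
    next
      fix r x y assume r: "r \<in> carrier K" and "(x, y) \<in> G'"
      then obtain u v s where
        *: "(u, v) \<in> G" "s \<in> carrier K" "x = u \<oplus>\<^bsub>B\<^esub> s \<odot>\<^bsub>B\<^esub> b" "y = v \<oplus>\<^bsub>Z\<^esub> s \<odot>\<^bsub>Z\<^esub> z"
        unfolding G'_def by blast
      then show "(r \<odot>\<^bsub>B\<^esub> x, r \<odot>\<^bsub>Z\<^esub> y) \<in> G'"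
        using G'I[OF Gsm[OF r *(1)], of "r \<otimes>\<^bsub>K\<^esub> s"] Gsub[OF *(1)] b z r
        by (simp add: B.smult_r_distr Z.smult_r_distr B.smult_assoc1 Z.smult_assoc1)
    next
      fix y assume "(\<zero>\<^bsub>B\<^esub>, y) \<in> G'"
      then obtain u v s where
        *: "(u, v) \<in> G" "s \<in> carrier K" "\<zero>\<^bsub>B\<^esub> = u \<oplus>\<^bsub>B\<^esub> s \<odot>\<^bsub>B\<^esub> b" "y = v \<oplus>\<^bsub>Z\<^esub> s \<odot>\<^bsub>Z\<^esub> z"
        unfolding G'_def by blast
      have "s \<odot>\<^bsub>B\<^esub> b = \<ominus>\<^bsub>B\<^esub> u"
        using *(2) *(3)[symmetric] b Gsub[OF *(1)]
        by (intro B.M.minus_equality[symmetric]) (simp_all add: B.M.a_comm)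
      then have sG: "(s \<odot>\<^bsub>B\<^esub> b, \<ominus>\<^bsub>Z\<^esub> v) \<in> G" using Gneg[OF *(1)] by simp
      then have "s \<in> I" using *(2) by (auto simp: I_def)
      then have "s \<odot>\<^bsub>Z\<^esub> z = \<ominus>\<^bsub>Z\<^esub> v" using Guniq[OF h sG] hz by simp
      then show "y = \<zero>\<^bsub>Z\<^esub>" using *(4) Gsub[OF *(1)] by (simp add: Z.M.r_neg)
    qed
    then have "G' = G" using max GG' by blast
    moreover have "(b, z) \<in> G'" using G'I[OF Gzz, of "\<one>\<^bsub>K\<^esub>"] b z by simp
    ultimately show ?thesis by auto
  qed
  define g where "g = (\<lambda>b\<in>carrier B. THE y. (b, y) \<in> G)"
  have g: "(b, g b) \<in> G" if "b \<in> carrier B" for b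
  proof -
    have "\<exists>!y. (b, y) \<in> G" using dom[OF that] Guniq by auto
    from theI'[OF this] show ?thesis using that by (simp add: g_def)
  qed
  have "g \<in> mod_hom K B Z"
  proof (rule mod_homI)
    show "g \<in> extensional (carrier B)" by (simp add: g_def)
  next
    fix x assume "x \<in> carrier B" then show "g x \<in> carrier Z" using Gsub(2)[OF g] by simp
  next
    fix x y assume "x \<in> carrier B" "y \<in> carrier B"
    then show "g (x \<oplus>\<^bsub>B\<^esub> y) = g x \<oplus>\<^bsub>Z\<^esub> g y" using Guniq[OF g Gadd[OF g g]] by simp
  next
    fix r x assume "r \<in> carrier K" "x \<in> carrier B"
    then show "g (r \<odot>\<^bsub>B\<^esub> x) = r \<odot>\<^bsub>Z\<^esub> g x" using Guniq[OF g Gsm[OF _ g]] by simp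
  qed
  moreover have "compose (carrier A) g i = f"
  proof (rule extensionalityI[of _ "carrier A"])
    show "f \<in> extensional (carrier A)" by (rule mod_homD(1)[OF f])
    fix a assume a: "a \<in> carrier A"
    then show "compose (carrier A) g i a = f a"
      using Guniq[OF g G0[OF a]] mod_homD(2)[OF i] by (simp add: compose_def)
  qed simp
  ultimately show "\<exists>g\<in>mod_hom K B Z. compose (carrier A) g i = f" by blast
qed

theorem cogenerator_universe:
  fixes K :: "('r, 'q) ring_scheme"
  assumes injZ: "injective_module TYPE('r set) K Z" and cog: "cogenerator TYPE('r set) K Z"
  shows "cogenerator TYPE('w) K Z"
  unfolding cogenerator_def
proof (intro conjI allI impI ballI)
  show Z: "module K Z" using cog by (simp add: cogenerator_def)
  interpret Z: module K Z by fact
  fix W :: "('r, 'w) module" and w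
  assume W: "module K W" and w: "w \<in> carrier W" and nz: "w \<noteq> \<zero>\<^bsub>W\<^esub>"
  interpret W: module K W by fact
  let ?S = "(\<lambda>r. r \<odot>\<^bsub>W\<^esub> w) ` carrier K"
  let ?W = "W\<lparr>carrier := ?S\<rparr>"
  have sub: "submodule ?S K W"
  proof (rule W.submoduleI)
    show "\<zero>\<^bsub>W\<^esub> \<in> ?S" using w by (intro image_eqI[of _ _ "\<zero>\<^bsub>K\<^esub>"]) auto
    show "\<ominus>\<^bsub>W\<^esub> x \<in> ?S" if "x \<in> ?S" for x
      using that w by (auto simp: W.smult_l_minus[symmetric])
    show "x \<oplus>\<^bsub>W\<^esub> y \<in> ?S" if "x \<in> ?S" "y \<in> ?S" for x y
      using that w by (auto simp: W.smult_l_distr[symmetric])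
    show "r \<odot>\<^bsub>W\<^esub> x \<in> ?S" if "r \<in> carrier K" "x \<in> ?S" for r x
      using that w by (auto simp: W.smult_assoc1[symmetric])
  qed (use w in auto)
  have M: "module K ?W" by (rule submodule.submodule_is_module[OF sub W])
  define e where "e = (\<lambda>x. {r \<in> carrier K. r \<odot>\<^bsub>W\<^esub> w = x})"
  have e: "inj_on e (carrier ?W)" by (auto simp: inj_on_def e_def)
  have wS: "w \<in> ?S" using w by (intro image_eqI[of _ _ "\<one>\<^bsub>K\<^esub>"]) auto
  have zS: "\<zero>\<^bsub>W\<^esub> \<in> ?S" using w by (intro image_eqI[of _ _ "\<zero>\<^bsub>K\<^esub>"]) auto
  let ?P = "push_module e ?W"
  have "e w \<in> carrier ?P" using wS by (auto simp: push_module_def Let_def)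
  moreover have "e w \<noteq> \<zero>\<^bsub>?P\<^esub>"
    using inj_onD[OF e, of w "\<zero>\<^bsub>W\<^esub>"] wS zS nz by (auto simp: push_module_def Let_def)
  ultimately obtain p where p: "p \<in> mod_hom K ?P Z" "p (e w) \<noteq> \<zero>\<^bsub>Z\<^esub>"
    using cog push_module(1)[OF M e] unfolding cogenerator_def by metis
  let ?f = "compose (carrier ?W) p (restrict e (carrier ?W))"
  have f: "?f \<in> mod_hom K ?W Z"
    by (rule mod_hom_compose[OF M push_module(2)[OF M e] p(1)])
  have "(\<lambda>x\<in>?S. x) \<in> mod_hom K ?W W"
    by (rule mod_homI)
      (use w module.smult_closed[OF M] abelian_monoid.a_closed[of ?W] M in
        \<open>auto simp: module_def abelian_group_def\<close>)
  moreover have "inj_on (\<lambda>x\<in>?S. x) (carrier ?W)" by (auto simp: inj_on_def)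
  ultimately obtain g where g: "g \<in> mod_hom K W Z" "compose (carrier ?W) g (\<lambda>x\<in>?S. x) = ?f"
    using injective_module_universe[OF injZ, where 'w = 'w] M W f
    unfolding injective_module_def by metis
  have "g w = p (e w)" using fun_cong[OF g(2), of w] wS by (simp add: compose_def)
  then show "\<exists>f\<in>mod_hom K W Z. f w \<noteq> \<zero>\<^bsub>Z\<^esub>" using g(1) p(2)
    by (intro bexI[of _ g]) simp_all
qed

end

theory Submission
  imports Defs
begin

text \<open>Let \<open>\<phi>\<close> be a bimodule endomorphism of \<open>U\<^sup>*\<close>, and let \<open>\<rho>\<close>, \<open>\<rho>'\<close> in \<open>U\<^sup>*\<close> and \<open>u\<close>, \<open>u'\<close> in \<open>U\<close> be
  given.  The key point is that some \<open>f\<close> in \<open>End\<^sub>R(U)\<close> satisfies \<open>\<rho>(f u) = \<phi>(\<rho>)(u)\<close> and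
  \<open>\<rho>'(f u') = \<phi>(\<rho>')(u')\<close>.  Applied to \<open>\<rho>\<close>, \<open>g u\<close> and \<open>\<rho> \<circ> g\<close>, \<open>u\<close> with \<open>g\<close> in the biendomorphism ring,
  \<open>g f = f g\<close> gives \<open>\<phi>(\<rho>)(g u) = \<phi>(\<rho> \<circ> g)(u)\<close>, so \<open>\<phi>\<close> commutes with the adjoint of \<open>g\<close>.

  By the FRCP it suffices to find, for a finitely related \<open>D\<close> and a balanced \<open>C'\<close>-equivariant pairing
  \<open>B : U\<^sup>* \<times> D \<rightarrow> Z\<close> (here \<open>B(\<rho>, d) = \<phi>(\<rho>)(p d)\<close> with a projection \<open>p\<close> onto \<open>U\<close>), an \<open>R\<close>-linear
  \<open>h : D \<rightarrow> U\<close> with \<open>\<rho>(h d) = B(\<rho>, d)\<close> for two given pairs \<open>(\<rho>, d)\<close>.  Only finitely many free generators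
  of \<open>D\<close>, forming a set \<open>Y\<close>, occur in the two elements \<open>d\<close> and in the relations, so \<open>h\<close> amounts to a point
  of \<open>V = U\<^sup>Y\<close> on which certain \<open>C\<close>-linear maps \<open>V \<rightarrow> U\<close> vanish and two \<open>C\<close>-linear maps \<open>V \<rightarrow> Z\<close> take
  prescribed values.  The pairing induces a \<open>C'\<close>-linear functional \<open>\<Psi>\<close> on \<open>Hom\<^sub>C(V, Z)\<close> that behaves as
  evaluation at the desired point would, and injectivity and the cogenerator property of \<open>Z\<close> turn this
  into an actual point.\<close>

section \<open>Modules over arbitrary rings\<close>

lemma add_hom_zero:
  assumes "abelian_group M" "abelian_group N" "f \<in> add_hom M N"
  shows "f \<zero>\<^bsub>M\<^esub> = \<zero>\<^bsub>N\<^esub>"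
proof -
  interpret M: abelian_group M by fact
  interpret N: abelian_group N by fact
  have "f \<zero>\<^bsub>M\<^esub> \<oplus>\<^bsub>N\<^esub> f \<zero>\<^bsub>M\<^esub> = f \<zero>\<^bsub>M\<^esub>"
    using add_homD(3)[OF assms(3), of "\<zero>\<^bsub>M\<^esub>" "\<zero>\<^bsub>M\<^esub>"] by simp
  then show ?thesis using add_homD(2)[OF assms(3)] by (metis M.zero_closed N.add.r_cancel_one')
qed

lemma add_hom_neg:
  assumes "abelian_group M" "abelian_group N" "f \<in> add_hom M N" "x \<in> carrier M"
  shows "f (\<ominus>\<^bsub>M\<^esub> x) = \<ominus>\<^bsub>N\<^esub> f x"
proof -
  interpret M: abelian_group M by fact
  interpret N: abelian_group N by fact
  have "f (\<ominus>\<^bsub>M\<^esub> x) \<oplus>\<^bsub>N\<^esub> f x = \<zero>\<^bsub>N\<^esub>"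
    using add_homD(3)[OF assms(3), of "\<ominus>\<^bsub>M\<^esub> x" x] add_hom_zero[OF assms(1-3)] assms(4)
    by (simp add: M.l_neg)
  then show ?thesis
    using assms(4) add_homD(2)[OF assms(3)] by (metis N.minus_equality M.a_inv_closed)
qed

text \<open>Over an infinite \<open>A\<close> both sums are zero by convention, so the induction
  covers that case too and later uses need no finiteness side condition.\<close>

lemma add_hom_finsum:
  assumes "abelian_group M" "abelian_group N" "f \<in> add_hom M N" "h \<in> A \<rightarrow> carrier M"
  shows "f (finsum M h A) = finsum N (\<lambda>a. f (h a)) A"
proof -
  interpret M: abelian_group M by fact
  interpret N: abelian_group N by fact
  show ?thesis
    using assms(4)
  proof (induct A rule: infinite_finite_induct)
    case (insert a A)
    then have "h \<in> A \<rightarrow> carrier M" "h a \<in> carrier M" by auto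
    moreover have "(\<lambda>a. f (h a)) \<in> A \<rightarrow> carrier N" "f (h a) \<in> carrier N"
      using insert(4) add_homD(2)[OF assms(3)] by auto
    ultimately show ?case using insert(1-3)
      by (simp add: add_homD(3)[OF assms(3)])
  qed (simp_all add: add_hom_zero[OF assms(1-3)])
qed

lemma mod_hom_add_hom: "f \<in> mod_hom R M N \<Longrightarrow> f \<in> add_hom M N"
  by (simp add: mod_hom_def)

section \<open>Submodules, quotients and direct summands\<close>

context left_module
begin

lemma smult_zero_right: "r \<in> carrier R \<Longrightarrow> r \<odot>\<^bsub>M\<^esub> \<zero>\<^bsub>M\<^esub> = \<zero>\<^bsub>M\<^esub>"
  by (metis M.add.r_cancel_one' M.zero_closed M.r_zero smult_closed smult_r_distr)

lemma smult_neg: "r \<in> carrier R \<Longrightarrow> x \<in> carrier M \<Longrightarrow> r \<odot>\<^bsub>M\<^esub> (\<ominus>\<^bsub>M\<^esub> x) = \<ominus>\<^bsub>M\<^esub> (r \<odot>\<^bsub>M\<^esub> x)"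
  by (metis M.a_inv_closed M.l_neg M.minus_equality smult_closed smult_r_distr smult_zero_right)

lemma hom_compose:
  assumes "f \<in> mod_hom R M N" "g \<in> mod_hom R N P"
  shows "compose (carrier M) g f \<in> mod_hom R M P"
  by (rule mod_homI) (simp_all add: compose_def mod_homD[OF assms(1)] mod_homD[OF assms(2)])

lemma hom_zero: "abelian_group N \<Longrightarrow> f \<in> mod_hom R M N \<Longrightarrow> f \<zero>\<^bsub>M\<^esub> = \<zero>\<^bsub>N\<^esub>"
  by (rule add_hom_zero[OF M.abelian_group_axioms _ mod_hom_add_hom])

lemma hom_neg:
  "abelian_group N \<Longrightarrow> f \<in> mod_hom R M N \<Longrightarrow> x \<in> carrier M \<Longrightarrow> f (\<ominus>\<^bsub>M\<^esub> x) = \<ominus>\<^bsub>N\<^esub> f x"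
  by (rule add_hom_neg[OF M.abelian_group_axioms _ mod_hom_add_hom])

lemma is_submodule_iff:
  "submodule H R M \<longleftrightarrow> H \<subseteq> carrier M \<and> \<zero>\<^bsub>M\<^esub> \<in> H \<and> (\<forall>a\<in>H. \<ominus>\<^bsub>M\<^esub> a \<in> H) \<and>
     (\<forall>a\<in>H. \<forall>b\<in>H. a \<oplus>\<^bsub>M\<^esub> b \<in> H) \<and> (\<forall>r\<in>carrier R. \<forall>x\<in>H. r \<odot>\<^bsub>M\<^esub> x \<in> H)"
  by (auto simp: submodule_def submodule_axioms_def subgroup_def a_inv_def subset_iff)

lemma submodule_carrier: "submodule (carrier M) R M"
  by (simp add: is_submodule_iff)

lemma submodule_left_module:
  assumes "submodule H R M" shows "left_module R (M\<lparr>carrier := H\<rparr>)"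
proof -
  note H = assms[unfolded is_submodule_iff]
  have HM: "x \<in> H \<Longrightarrow> x \<in> carrier M" for x using H by blast
  have "abelian_group (M\<lparr>carrier := H\<rparr>)"
    by (rule abelian_groupI) (use H HM in \<open>auto simp: M.a_ac intro!: bexI[of _ "\<ominus>\<^bsub>M\<^esub> x" for x] M.l_neg M.r_neg\<close>)
  then show ?thesis
    by (intro left_module.intro left_module_axioms.intro R.ring_axioms)
      (use H HM in \<open>auto simp: smult_l_distr smult_r_distr smult_assoc1\<close>)
qed

lemma kernel_submodule:
  assumes "left_module R N" "f \<in> mod_hom R M N"
  shows "submodule {x \<in> carrier M. f x = \<zero>\<^bsub>N\<^esub>} R M"
proof -
  interpret N: left_module R N by fact
  note ag = N.M.abelian_group_axioms
  show ?thesis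
    by (auto simp: is_submodule_iff hom_zero[OF ag assms(2)] hom_neg[OF ag assms(2)]
        mod_homD[OF assms(2)] N.smult_zero_right)
qed

lemma submodule_Int:
  "submodule H R M \<Longrightarrow> submodule H' R M \<Longrightarrow> submodule (H \<inter> H') R M"
  by (auto simp: is_submodule_iff)

lemma image_submodule:
  assumes "left_module R N" "f \<in> mod_hom R M N" "submodule H R M"
  shows "submodule (f ` H) R N"
proof -
  interpret N: left_module R N by fact
  note H = assms(3)[unfolded is_submodule_iff]
  note ag = N.M.abelian_group_axioms
  note f = mod_homD[OF assms(2)]
  have HM: "x \<in> H \<Longrightarrow> x \<in> carrier M" for x using H by blast
  show ?thesis
    unfolding N.is_submodule_iff
  proof (intro conjI ballI)
    show "\<zero>\<^bsub>N\<^esub> \<in> f ` H" using H hom_zero[OF ag assms(2)] by (intro image_eqI[of _ _ "\<zero>\<^bsub>M\<^esub>"]) auto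
    fix y assume "y \<in> f ` H"
    then obtain x where x: "x \<in> H" "y = f x" by blast
    then show "\<ominus>\<^bsub>N\<^esub> y \<in> f ` H"
      using H HM hom_neg[OF ag assms(2)] by (intro image_eqI[of _ _ "\<ominus>\<^bsub>M\<^esub> x"]) auto
    show "r \<odot>\<^bsub>N\<^esub> y \<in> f ` H" if "r \<in> carrier R" for r
      using that x H HM f(4) by (intro image_eqI[of _ _ "r \<odot>\<^bsub>M\<^esub> x"]) auto
    fix y' assume "y' \<in> f ` H"
    then obtain x' where "x' \<in> H" "y' = f x'" by blast
    then show "y \<oplus>\<^bsub>N\<^esub> y' \<in> f ` H"
      using x H HM f(3) by (intro image_eqI[of _ _ "x \<oplus>\<^bsub>M\<^esub> x'"]) auto
  qed (use HM f(2) in auto)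
qed

lemma span_submodule:
  assumes "S \<subseteq> carrier M" shows "submodule (submodule_span R M S) R M"
proof -
  have "submodule_span R M S \<subseteq> carrier M"
    using assms submodule_carrier by (auto simp: submodule_span_def)
  then show ?thesis
    using is_submodule_iff by (simp add: submodule_span_def)
qed

lemma span_least: "submodule N R M \<Longrightarrow> S \<subseteq> N \<Longrightarrow> submodule_span R M S \<subseteq> N"
  by (auto simp: submodule_span_def)

lemma span_superset: "S \<subseteq> submodule_span R M S"
  by (auto simp: submodule_span_def)

lemma bij_hom_inverse:
  assumes f: "f \<in> mod_hom R M N" and bij: "bij_betw f (carrier M) (carrier N)"
  obtains g where "g \<in> mod_hom R N M" "\<And>x. x \<in> carrier M \<Longrightarrow> g (f x) = x"
    "\<And>y. y \<in> carrier N \<Longrightarrow> f (g y) = y"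
proof
  define g where "g = restrict (the_inv_into (carrier M) f) (carrier N)"
  note D = mod_homD[OF f]
  have inj: "inj_on f (carrier M)" and im: "f ` carrier M = carrier N"
    using bij by (auto simp: bij_betw_def)
  show gf: "g (f x) = x" if "x \<in> carrier M" for x
    using that D(2) inj by (simp add: g_def the_inv_into_f_f)
  show fg: "f (g y) = y" if "y \<in> carrier N" for y
    using that im inj by (auto simp: g_def f_the_inv_into_f)
  show "g \<in> mod_hom R N M"
  proof (rule mod_homI)
    show "g \<in> extensional (carrier N)" by (simp add: g_def)
    show "g y \<in> carrier M" if "y \<in> carrier N" for y
      using that gf unfolding im[symmetric] by auto
    show "g (y \<oplus>\<^bsub>N\<^esub> y') = g y \<oplus>\<^bsub>M\<^esub> g y'" if "y \<in> carrier N" "y' \<in> carrier N" for y y'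
    proof -
      from that obtain x x' where "x \<in> carrier M" "x' \<in> carrier M" "y = f x" "y' = f x'"
        unfolding im[symmetric] by blast
      then show ?thesis using gf by (simp flip: D(3))
    qed
    show "g (r \<odot>\<^bsub>N\<^esub> y) = r \<odot>\<^bsub>M\<^esub> g y" if "r \<in> carrier R" "y \<in> carrier N" for r y
    proof -
      from that obtain x where "x \<in> carrier M" "y = f x" unfolding im[symmetric] by blast
      then show ?thesis using gf that by (simp flip: D(4))
    qed
  qed
qed

text \<open>The zero of the quotient is written as the coset of \<open>\<zero>\<close>, so that the
  criterion for equal cosets also decides which cosets vanish.\<close>

lemma quot_module:
  assumes K: "submodule K R M"
  shows "left_module R (quot_module M K)"
    and "(\<lambda>x\<in>carrier M. K +>\<^bsub>M\<^esub> x) \<in> mod_hom R M (quot_module M K)"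
    and "carrier (quot_module M K) = (\<lambda>x. K +>\<^bsub>M\<^esub> x) ` carrier M"
    and "\<zero>\<^bsub>quot_module M K\<^esub> = K +>\<^bsub>M\<^esub> \<zero>\<^bsub>M\<^esub>"
    and "\<And>x y. x \<in> carrier M \<Longrightarrow> y \<in> carrier M \<Longrightarrow>
      K +>\<^bsub>M\<^esub> x = K +>\<^bsub>M\<^esub> y \<longleftrightarrow> x \<oplus>\<^bsub>M\<^esub> \<ominus>\<^bsub>M\<^esub> y \<in> K"
proof -
  have sub: "additive_subgroup K M"
    using K by (auto simp: submodule_def intro: additive_subgroupI)
  interpret K: abelian_subgroup K M
    by (rule abelian_subgroupI3[OF sub M.abelian_group_axioms])
  let ?Q = "quot_module M K"
  note Ks = K[unfolded is_submodule_iff]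
  have KM: "x \<in> K \<Longrightarrow> x \<in> carrier M" for x using Ks by blast
  show car: "carrier ?Q = (\<lambda>x. K +>\<^bsub>M\<^esub> x) ` carrier M"
    by (auto simp: quot_module_def A_RCOSETS_def')
  show zero: "\<zero>\<^bsub>?Q\<^esub> = K +>\<^bsub>M\<^esub> \<zero>\<^bsub>M\<^esub>"
    using K.a_subset by (simp add: quot_module_def)
  show eq: "K +>\<^bsub>M\<^esub> x = K +>\<^bsub>M\<^esub> y \<longleftrightarrow> x \<oplus>\<^bsub>M\<^esub> \<ominus>\<^bsub>M\<^esub> y \<in> K"
    if "x \<in> carrier M" "y \<in> carrier M" for x y
    using that by (metis K.a_rcos_module K.a_rcos_self K.a_repr_independence')
  have add: "(K +>\<^bsub>M\<^esub> x) \<oplus>\<^bsub>?Q\<^esub> (K +>\<^bsub>M\<^esub> y) = K +>\<^bsub>M\<^esub> (x \<oplus>\<^bsub>M\<^esub> y)"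
    if "x \<in> carrier M" "y \<in> carrier M" for x y
    using that by (simp add: quot_module_def K.a_rcos_sum)
  have smult: "r \<odot>\<^bsub>?Q\<^esub> (K +>\<^bsub>M\<^esub> x) = K +>\<^bsub>M\<^esub> (r \<odot>\<^bsub>M\<^esub> x)"
    if r: "r \<in> carrier R" and x: "x \<in> carrier M" for r x
  proof -
    \<comment> \<open>In one direction \<open>r k'\<close> is absorbed by \<open>K\<close>; in the
      other, \<open>x\<close> itself represents its coset.\<close>
    have "K <+>\<^bsub>M\<^esub> ((\<lambda>x. r \<odot>\<^bsub>M\<^esub> x) ` (K +>\<^bsub>M\<^esub> x)) = K +>\<^bsub>M\<^esub> (r \<odot>\<^bsub>M\<^esub> x)" (is "?A = ?B")
    proof (intro equalityI subsetI)
      fix y assume "y \<in> ?A"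
      then obtain k k' where k: "k \<in> K" "k' \<in> K" "y = k \<oplus>\<^bsub>M\<^esub> r \<odot>\<^bsub>M\<^esub> (k' \<oplus>\<^bsub>M\<^esub> x)"
        by (auto simp: set_add_def' a_r_coset_def')
      then have "y = (k \<oplus>\<^bsub>M\<^esub> r \<odot>\<^bsub>M\<^esub> k') \<oplus>\<^bsub>M\<^esub> r \<odot>\<^bsub>M\<^esub> x"
        using r x KM by (simp add: smult_r_distr M.a_assoc)
      moreover have "k \<oplus>\<^bsub>M\<^esub> r \<odot>\<^bsub>M\<^esub> k' \<in> K" using k r Ks by blast
      ultimately show "y \<in> ?B" by (auto simp: a_r_coset_def')
    next
      fix y assume "y \<in> ?B"
      then obtain k where k: "k \<in> K" "y = k \<oplus>\<^bsub>M\<^esub> r \<odot>\<^bsub>M\<^esub> x" by (auto simp: a_r_coset_def')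
      moreover have "x \<in> K +>\<^bsub>M\<^esub> x" using x by (rule K.a_rcos_self)
      ultimately show "y \<in> ?A" by (auto simp: set_add_def')
    qed
    then show ?thesis by (simp add: quot_module_def)
  qed
  show "(\<lambda>x\<in>carrier M. K +>\<^bsub>M\<^esub> x) \<in> mod_hom R M ?Q"
    by (rule mod_homI) (auto simp: car add smult)
  have "abelian_group ?Q"
  proof (rule abelian_groupI)
    show "\<exists>y\<in>carrier ?Q. y \<oplus>\<^bsub>?Q\<^esub> x = \<zero>\<^bsub>?Q\<^esub>" if "x \<in> carrier ?Q" for x
    proof -
      obtain a where a: "a \<in> carrier M" "x = K +>\<^bsub>M\<^esub> a" using \<open>x \<in> carrier ?Q\<close> car by auto
      then have "(K +>\<^bsub>M\<^esub> \<ominus>\<^bsub>M\<^esub> a) \<oplus>\<^bsub>?Q\<^esub> x = \<zero>\<^bsub>?Q\<^esub>" by (simp add: add zero M.l_neg)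
      then show ?thesis using a car by auto
    qed
  qed (auto simp: car add zero M.a_ac simp del: M.add.coset_mult_one a_coset_add_zero)
  then show "left_module R ?Q"
    by (intro left_module.intro left_module_axioms.intro R.ring_axioms)
      (auto simp: car add smult smult_l_distr smult_r_distr smult_assoc1)
qed

text \<open>A preimage under \<open>p\<close> is chosen for each element of \<open>N\<close>;
  constancy of \<open>f\<close> on the fibres of \<open>p\<close> makes the choice immaterial. It
  serves both to carry a functional over to the image of a map and to descend from a free module to
  a quotient of it.\<close>

lemma hom_factor:
  assumes N: "left_module R N" and p: "p \<in> mod_hom R M N" "p ` carrier M = carrier N"
    and f: "f \<in> mod_hom R M P"
    and ker: "\<And>x y. x \<in> carrier M \<Longrightarrow> y \<in> carrier M \<Longrightarrow> p x = p y \<Longrightarrow> f x = f y"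
  obtains h where "h \<in> mod_hom R N P" "\<And>x. x \<in> carrier M \<Longrightarrow> h (p x) = f x"
proof
  interpret N: left_module R N by fact
  define h where "h = (\<lambda>y\<in>carrier N. f (inv_into (carrier M) p y))"
  note D = mod_homD[OF p(1)] and Df = mod_homD[OF f]
  show hp: "h (p x) = f x" if "x \<in> carrier M" for x
  proof -
    have "inv_into (carrier M) p (p x) \<in> carrier M" "p (inv_into (carrier M) p (p x)) = p x"
      using that by (auto intro: inv_into_into f_inv_into_f)
    then show ?thesis using ker[OF _ that] D(2)[OF that] by (simp add: h_def)
  qed
  have ex: "\<exists>x\<in>carrier M. y = p x" if "y \<in> carrier N" for y
    using that unfolding p(2)[symmetric] by blast
  show "h \<in> mod_hom R N P"
  proof (rule mod_homI)
    show "h \<in> extensional (carrier N)" by (simp add: h_def)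
    show "h y \<in> carrier P" if "y \<in> carrier N" for y
    proof -
      from ex[OF that] obtain x where "x \<in> carrier M" "y = p x" ..
      then show ?thesis using hp Df(2) by simp
    qed
    show "h (y \<oplus>\<^bsub>N\<^esub> y') = h y \<oplus>\<^bsub>P\<^esub> h y'" if "y \<in> carrier N" "y' \<in> carrier N" for y y'
    proof -
      from ex[OF that(1)] obtain x where "x \<in> carrier M" "y = p x" ..
      moreover from ex[OF that(2)] obtain x' where "x' \<in> carrier M" "y' = p x'" ..
      ultimately show ?thesis using hp Df(3) by (simp flip: D(3))
    qed
    show "h (r \<odot>\<^bsub>N\<^esub> y) = r \<odot>\<^bsub>P\<^esub> h y" if "r \<in> carrier R" "y \<in> carrier N" for r y
    proof -
      from ex[OF that(2)] obtain x where "x \<in> carrier M" "y = p x" ..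
      then show ?thesis using hp that Df(4) by (simp flip: D(4))
    qed
  qed
qed

text \<open>Two decompositions of one element differ by an element of \<open>D \<inter> E\<close>,
  which is zero; hence the component in \<open>D\<close> is well defined and depends linearly on the
  element.\<close>

lemma direct_summand_projection:
  assumes "direct_summand D R M"
  obtains q where "q \<in> mod_hom R M (M\<lparr>carrier := D\<rparr>)" "\<And>d. d \<in> D \<Longrightarrow> q d = d"
proof -
  obtain E where DE: "submodule D R M" "submodule E R M" "D \<inter> E = {\<zero>\<^bsub>M\<^esub>}" "D <+>\<^bsub>M\<^esub> E = carrier M"
    using assms by (auto simp: direct_summand_def)
  note D = DE(1)[unfolded is_submodule_iff] and E = DE(2)[unfolded is_submodule_iff]
  have DM: "x \<in> D \<Longrightarrow> x \<in> carrier M" and EM: "x \<in> E \<Longrightarrow> x \<in> carrier M" for x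
    using D E by blast+
  have uniq: "d = d'" if "d \<in> D" "d' \<in> D" "e \<in> E" "e' \<in> E" "d \<oplus>\<^bsub>M\<^esub> e = d' \<oplus>\<^bsub>M\<^esub> e'" for d d' e e'
  proof -
    have m: "d \<in> carrier M" "d' \<in> carrier M" "e \<in> carrier M" "e' \<in> carrier M"
      using that DM EM by auto
    have "d \<oplus>\<^bsub>M\<^esub> \<ominus>\<^bsub>M\<^esub> d' = (d \<oplus>\<^bsub>M\<^esub> e) \<oplus>\<^bsub>M\<^esub> (\<ominus>\<^bsub>M\<^esub> d' \<oplus>\<^bsub>M\<^esub> \<ominus>\<^bsub>M\<^esub> e)"
      using m by (simp add: M.a_ac M.r_neg2 M.r_neg1 M.r_neg)
    also have "\<dots> = e' \<oplus>\<^bsub>M\<^esub> \<ominus>\<^bsub>M\<^esub> e"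
      unfolding that(5) using m by (simp add: M.a_comm[of d' e'] M.a_assoc M.r_neg2)
    finally have eq: "d \<oplus>\<^bsub>M\<^esub> \<ominus>\<^bsub>M\<^esub> d' = e' \<oplus>\<^bsub>M\<^esub> \<ominus>\<^bsub>M\<^esub> e" .
    have "d \<oplus>\<^bsub>M\<^esub> \<ominus>\<^bsub>M\<^esub> d' \<in> D" using that D by blast
    moreover have "e' \<oplus>\<^bsub>M\<^esub> \<ominus>\<^bsub>M\<^esub> e \<in> E" using that E by blast
    ultimately have "d \<oplus>\<^bsub>M\<^esub> \<ominus>\<^bsub>M\<^esub> d' \<in> D \<inter> E" using eq by simp
    then have "d \<oplus>\<^bsub>M\<^esub> \<ominus>\<^bsub>M\<^esub> d' = \<zero>\<^bsub>M\<^esub>" using DE(3) by blast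
    then show ?thesis using m by (metis M.a_inv_closed M.minus_equality M.minus_minus)
  qed
  define q where "q = (\<lambda>x\<in>carrier M. THE d. d \<in> D \<and> (\<exists>e\<in>E. x = d \<oplus>\<^bsub>M\<^esub> e))"
  have q: "q (d \<oplus>\<^bsub>M\<^esub> e) = d" if "d \<in> D" "e \<in> E" for d e
    using that DM EM uniq by (auto simp: q_def intro!: the_equality)
  have ex: "\<exists>d\<in>D. \<exists>e\<in>E. x = d \<oplus>\<^bsub>M\<^esub> e" if "x \<in> carrier M" for x
    using that unfolding DE(4)[symmetric] by (auto simp: set_add_def')
  show ?thesis
  proof
    show "q d = d" if "d \<in> D" for d
      using q[OF that, of "\<zero>\<^bsub>M\<^esub>"] E DM[OF that] by simp
    show "q \<in> mod_hom R M (M\<lparr>carrier := D\<rparr>)"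
    proof (rule mod_homI)
      show "q \<in> extensional (carrier M)" by (simp add: q_def)
      show "q x \<in> carrier (M\<lparr>carrier := D\<rparr>)" if "x \<in> carrier M" for x
        using ex[OF that] q by auto
      show "q (x \<oplus>\<^bsub>M\<^esub> y) = q x \<oplus>\<^bsub>M\<lparr>carrier := D\<rparr>\<^esub> q y"
        if x: "x \<in> carrier M" and y: "y \<in> carrier M" for x y
      proof -
        obtain d e d' e' where *: "d \<in> D" "e \<in> E" "x = d \<oplus>\<^bsub>M\<^esub> e" "d' \<in> D" "e' \<in> E" "y = d' \<oplus>\<^bsub>M\<^esub> e'"
          using ex[OF x] ex[OF y] by blast
        then have "x \<oplus>\<^bsub>M\<^esub> y = (d \<oplus>\<^bsub>M\<^esub> d') \<oplus>\<^bsub>M\<^esub> (e \<oplus>\<^bsub>M\<^esub> e')"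
          using DM EM by (simp add: M.a_ac)
        then show ?thesis using * D E q by simp
      qed
      show "q (r \<odot>\<^bsub>M\<^esub> x) = r \<odot>\<^bsub>M\<lparr>carrier := D\<rparr>\<^esub> q x" if r: "r \<in> carrier R" and x: "x \<in> carrier M" for r x
      proof -
        obtain d e where *: "d \<in> D" "e \<in> E" "x = d \<oplus>\<^bsub>M\<^esub> e" using ex[OF x] by blast
        then have "r \<odot>\<^bsub>M\<^esub> x = r \<odot>\<^bsub>M\<^esub> d \<oplus>\<^bsub>M\<^esub> r \<odot>\<^bsub>M\<^esub> e"
          using DM EM r by (simp add: smult_r_distr)
        then show ?thesis using * D E q r by simp
      qed
    qed
  qed
qed

end

section \<open>Free modules and powers of a module\<close>

lemma free_module_left_module:
  fixes R :: "('r, 'q) ring_scheme" and X :: "'x set"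
  assumes "ring R" shows "left_module R (free_module R X)"
proof -
  interpret ring R by fact
  let ?F = "free_module R X"
  have fin: "finite {x \<in> X. (\<lambda>x\<in>X. f x \<oplus>\<^bsub>R\<^esub> g x) x \<noteq> \<zero>\<^bsub>R\<^esub>}"
    if "finite {x \<in> X. f x \<noteq> \<zero>\<^bsub>R\<^esub>}" "finite {x \<in> X. g x \<noteq> \<zero>\<^bsub>R\<^esub>}" for f g :: "'x \<Rightarrow> 'r"
    by (rule finite_subset[OF _ finite_UnI[OF that]]) auto
  have fin1: "finite {x \<in> X. (\<lambda>x\<in>X. h (f x)) x \<noteq> \<zero>\<^bsub>R\<^esub>}"
    if "finite {x \<in> X. f x \<noteq> \<zero>\<^bsub>R\<^esub>}" "h \<zero>\<^bsub>R\<^esub> = \<zero>\<^bsub>R\<^esub>" for f :: "'x \<Rightarrow> 'r" and h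
    by (rule finite_subset[OF _ that(1)]) (use that(2) in auto)
  have car: "f \<in> carrier ?F \<longleftrightarrow> f \<in> X \<rightarrow>\<^sub>E carrier R \<and> finite {x \<in> X. f x \<noteq> \<zero>\<^bsub>R\<^esub>}" for f
    by (simp add: free_module_def)
  have sm: "r \<odot>\<^bsub>?F\<^esub> f \<in> carrier ?F" if "r \<in> carrier R" "f \<in> carrier ?F" for r f
    using that fin1[of f "\<lambda>y. r \<otimes>\<^bsub>R\<^esub> y"] by (auto simp: free_module_def)
  have "abelian_group ?F"
  proof (rule abelian_groupI)
    show "f \<oplus>\<^bsub>?F\<^esub> g \<in> carrier ?F" if "f \<in> carrier ?F" "g \<in> carrier ?F" for f g
      using that fin[of f g] by (auto simp: free_module_def)
    show "\<zero>\<^bsub>?F\<^esub> \<in> carrier ?F" by (auto simp: free_module_def)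
    show "\<exists>g\<in>carrier ?F. g \<oplus>\<^bsub>?F\<^esub> f = \<zero>\<^bsub>?F\<^esub>" if "f \<in> carrier ?F" for f
    proof
      show "(\<lambda>x\<in>X. \<ominus>\<^bsub>R\<^esub> f x) \<in> carrier ?F"
        using that fin1[of f "a_inv R"] by (auto simp: free_module_def)
      show "(\<lambda>x\<in>X. \<ominus>\<^bsub>R\<^esub> f x) \<oplus>\<^bsub>?F\<^esub> f = \<zero>\<^bsub>?F\<^esub>"
        using that by (auto simp: free_module_def l_neg PiE_iff intro!: restrict_ext)
    qed
    show "\<zero>\<^bsub>?F\<^esub> \<oplus>\<^bsub>?F\<^esub> f = f" if "f \<in> carrier ?F" for f
      using that by (intro extensionalityI[of _ X]) (auto simp: free_module_def PiE_iff)
  qed (auto simp: free_module_def PiE_iff a_ac intro!: restrict_ext)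
  moreover have "\<one>\<^bsub>R\<^esub> \<odot>\<^bsub>?F\<^esub> f = f" if "f \<in> carrier ?F" for f
    using that by (intro extensionalityI[of _ X]) (auto simp: free_module_def PiE_iff)
  ultimately show ?thesis
    by (intro left_module.intro left_module_axioms.intro assms sm)
      (auto simp: free_module_def PiE_iff l_distr r_distr m_assoc intro!: restrict_ext)
qed

text \<open>A point of \<open>power_module U Y\<close> will list the images in \<open>U\<close> of
  the free generators in \<open>Y\<close>.\<close>

definition power_module :: "('r, 'm, 's) module_scheme \<Rightarrow> 'i set \<Rightarrow> ('r, 'i \<Rightarrow> 'm) module" where
  "power_module M I = \<lparr>carrier = I \<rightarrow>\<^sub>E carrier M, mult = undefined, one = undefined,
     zero = (\<lambda>i\<in>I. \<zero>\<^bsub>M\<^esub>), add = (\<lambda>f g. \<lambda>i\<in>I. f i \<oplus>\<^bsub>M\<^esub> g i),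
     smult = (\<lambda>r f. \<lambda>i\<in>I. r \<odot>\<^bsub>M\<^esub> f i)\<rparr>"

lemma (in left_module) power_module_left_module: "left_module R (power_module M I)"
proof -
  let ?P = "power_module M I"
  have "abelian_group ?P"
  proof (rule abelian_groupI)
    show "\<exists>g\<in>carrier ?P. g \<oplus>\<^bsub>?P\<^esub> f = \<zero>\<^bsub>?P\<^esub>" if "f \<in> carrier ?P" for f
    proof
      show "(\<lambda>x\<in>I. \<ominus>\<^bsub>M\<^esub> f x) \<in> carrier ?P" using that by (auto simp: power_module_def)
      show "(\<lambda>x\<in>I. \<ominus>\<^bsub>M\<^esub> f x) \<oplus>\<^bsub>?P\<^esub> f = \<zero>\<^bsub>?P\<^esub>"
        using that by (auto simp: power_module_def M.l_neg PiE_iff intro!: restrict_ext)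
    qed
    show "\<zero>\<^bsub>?P\<^esub> \<oplus>\<^bsub>?P\<^esub> f = f" if "f \<in> carrier ?P" for f
      using that by (intro extensionalityI[of _ I]) (auto simp: power_module_def PiE_iff)
  qed (auto simp: power_module_def PiE_iff M.a_ac intro!: restrict_ext)
  moreover have "\<one>\<^bsub>R\<^esub> \<odot>\<^bsub>?P\<^esub> f = f" if "f \<in> carrier ?P" for f
    using that by (intro extensionalityI[of _ I]) (auto simp: power_module_def PiE_iff)
  ultimately show ?thesis
    by (intro left_module.intro left_module_axioms.intro R.ring_axioms)
      (auto simp: power_module_def PiE_iff smult_l_distr smult_r_distr smult_assoc1 intro!: restrict_ext)
qed


section \<open>Functionals on the dual of a module\<close>

text \<open>Injectivity is applied to the inclusion of \<open>H\<close>;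
  \<open>injective_module_universe\<close> makes it available for the element type of
  \<open>A\<close>.\<close>

lemma injective_module_extend:
  fixes K :: "('r, 'q) ring_scheme" and A :: "('r, 'a, 's) module_scheme"
  assumes inj: "injective_module TYPE('r set) K Z" and A: "module K A"
    and H: "submodule H K A" and h: "h \<in> mod_hom K (A\<lparr>carrier := H\<rparr>) Z"
  obtains s where "s \<in> mod_hom K A Z" "\<And>x. x \<in> H \<Longrightarrow> s x = h x"
proof -
  interpret A: left_module K A using A by (simp add: module_iff_left_module)
  interpret K: cring K using A by (simp add: module_iff_left_module)
  note Hs = H[unfolded A.is_submodule_iff]
  have HA: "x \<in> H \<Longrightarrow> x \<in> carrier A" for x using Hs by blast
  \<comment> \<open>The test modules in the definition of injectivity are records without extra
    fields, so \<open>A\<close> is replaced by its truncation, which has the same carrier and module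
    operations.\<close>
  define B :: "('r, 'a) module" where "B = module.truncate A"
  have B: "carrier B = carrier A" "add B = add A" "zero B = zero A" "smult B = smult A"
    by (simp_all add: B_def module.defs)
  have "abelian_group B"
    by (rule abelian_groupI)
      (auto simp: B A.M.a_ac intro!: bexI[of _ "\<ominus>\<^bsub>A\<^esub> x" for x] A.M.l_neg A.M.r_neg)
  then have mB: "module K B"
    by (intro moduleI K.is_cring) (auto simp: B A.smult_l_distr A.smult_r_distr A.smult_assoc1)
  then interpret B: left_module K B by (simp add: module_iff_left_module)
  have HB: "submodule H K B"
    using H by (simp add: submodule_def submodule_axioms_def subgroup_def m_inv_def B)
  have mH: "module K (B\<lparr>carrier := H\<rparr>)" by (rule submodule.submodule_is_module[OF HB mB])
  have "h \<in> mod_hom K (B\<lparr>carrier := H\<rparr>) Z"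
    using h by (simp add: mod_hom_def add_hom_def B)
  moreover have "(\<lambda>x\<in>H. x) \<in> mod_hom K (B\<lparr>carrier := H\<rparr>) B"
    by (rule mod_homI) (use Hs HA in \<open>auto simp: B\<close>)
  moreover have "inj_on (\<lambda>x\<in>H. x) (carrier (B\<lparr>carrier := H\<rparr>))" by (auto simp: inj_on_def)
  ultimately obtain s where s: "s \<in> mod_hom K B Z"
    "compose (carrier (B\<lparr>carrier := H\<rparr>)) s (\<lambda>x\<in>H. x) = h"
    using injective_module_universe[OF inj, where 'w = 'a] mB mH
    unfolding injective_module_def by metis
  show thesis
  proof
    show "s \<in> mod_hom K A Z" using s(1) by (simp add: mod_hom_def add_hom_def B)
    show "s x = h x" if "x \<in> H" for x
      using fun_cong[OF s(2), of x] that by (simp add: compose_def)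
  qed
qed

text \<open>The model for \<open>\<Psi>\<close> is evaluation at a point of \<open>V\<close>, and the model for \<open>supported_on N\<close> is that
  this point lies in \<open>N\<close>.\<close>

locale bidual_functional =
  fixes K :: "('r, 'q) ring_scheme" and V :: "('r, 'v, 's) module_scheme"
    and Z :: "('r, 'z, 't) module_scheme" and \<Psi> :: "('v \<Rightarrow> 'z) \<Rightarrow> 'z"
  assumes mod_V: "module K V" and mod_Z: "module K Z"
    and closed: "l \<in> mod_hom K V Z \<Longrightarrow> \<Psi> l \<in> carrier Z"
    and add: "l \<in> mod_hom K V Z \<Longrightarrow> l' \<in> mod_hom K V Z \<Longrightarrow>
      \<Psi> (\<lambda>v\<in>carrier V. l v \<oplus>\<^bsub>Z\<^esub> l' v) = \<Psi> l \<oplus>\<^bsub>Z\<^esub> \<Psi> l'"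
    and equivariant: "l \<in> mod_hom K V Z \<Longrightarrow> t \<in> mod_hom K Z Z \<Longrightarrow>
      \<Psi> (compose (carrier V) t l) = t (\<Psi> l)"
begin

sublocale V: left_module K V using mod_V by (simp add: module_iff_left_module)
sublocale Z: left_module K Z using mod_Z by (simp add: module_iff_left_module)

definition supported_on :: "'v set \<Rightarrow> bool" where
  "supported_on N \<longleftrightarrow> submodule N K V \<and>
     (\<forall>l\<in>mod_hom K V Z. (\<forall>v\<in>N. l v = \<zero>\<^bsub>Z\<^esub>) \<longrightarrow> \<Psi> l = \<zero>\<^bsub>Z\<^esub>)"

text \<open>A functional \<open>l\<close> vanishing on all of \<open>V\<close> satisfies
  \<open>l + l = l\<close>, and additivity of \<open>\<Psi>\<close> together with cancellation gives
  \<open>\<Psi> l = \<zero>\<close>.\<close>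

lemma supported_on_carrier: "supported_on (carrier V)"
  unfolding supported_on_def
proof (intro conjI ballI impI V.submodule_carrier)
  fix l assume l: "l \<in> mod_hom K V Z" and 0: "\<forall>v\<in>carrier V. l v = \<zero>\<^bsub>Z\<^esub>"
  have "(\<lambda>v\<in>carrier V. l v \<oplus>\<^bsub>Z\<^esub> l v) = l"
    by (rule extensionalityI[of _ "carrier V"]) (use 0 mod_homD[OF l] in auto)
  then have "\<Psi> l \<oplus>\<^bsub>Z\<^esub> \<Psi> l = \<Psi> l" using add[OF l l] by simp
  then show "\<Psi> l = \<zero>\<^bsub>Z\<^esub>" using closed[OF l] by (metis Z.M.add.r_cancel_one')
qed

text \<open>A functional vanishing on \<open>N \<inter> ker f\<close> agrees on \<open>N\<close> with some \<open>s \<circ> f\<close>, as \<open>Z\<close> is injective.\<close>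

lemma supported_on_kernel:
  fixes A :: "('r, 'a, 'b) module_scheme"
  assumes inj: "injective_module TYPE('r set) K Z" and N: "supported_on N"
    and A: "module K A" and f: "f \<in> mod_hom K V A"
    and vanish: "\<And>s. s \<in> mod_hom K A Z \<Longrightarrow> \<Psi> (compose (carrier V) s f) = \<zero>\<^bsub>Z\<^esub>"
  shows "supported_on (N \<inter> {v \<in> carrier V. f v = \<zero>\<^bsub>A\<^esub>})"
  unfolding supported_on_def
proof (intro conjI ballI impI)
  interpret A: left_module K A using A by (simp add: module_iff_left_module)
  have subN: "submodule N K V" using N by (simp add: supported_on_def)
  note Ns = subN[unfolded V.is_submodule_iff]
  have NV: "v \<in> N \<Longrightarrow> v \<in> carrier V" for v using Ns by blast
  show "submodule (N \<inter> {v \<in> carrier V. f v = \<zero>\<^bsub>A\<^esub>}) K V"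
    by (intro V.submodule_Int subN V.kernel_submodule[OF A.left_module_axioms f])
  fix l assume l: "l \<in> mod_hom K V Z"
    and 0: "\<forall>v\<in>N \<inter> {v \<in> carrier V. f v = \<zero>\<^bsub>A\<^esub>}. l v = \<zero>\<^bsub>Z\<^esub>"
  interpret N: left_module K "V\<lparr>carrier := N\<rparr>" by (rule V.submodule_left_module[OF subN])
  have subI: "submodule (f ` N) K A"
    by (rule V.image_submodule[OF A.left_module_axioms f subN])
  have "restrict f N \<in> mod_hom K (V\<lparr>carrier := N\<rparr>) (A\<lparr>carrier := f ` N\<rparr>)"
    by (rule mod_homI) (use Ns NV in \<open>auto simp: mod_homD[OF f]\<close>)
  moreover have "restrict f N ` carrier (V\<lparr>carrier := N\<rparr>) = carrier (A\<lparr>carrier := f ` N\<rparr>)"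
    by auto
  moreover have "restrict l N \<in> mod_hom K (V\<lparr>carrier := N\<rparr>) Z"
    by (rule mod_homI) (use Ns NV in \<open>auto simp: mod_homD[OF l]\<close>)
  \<comment> \<open>On \<open>N\<close>, \<open>l\<close> factors through \<open>f\<close>: if
    \<open>f x = f y\<close>, then \<open>x - y\<close> lies in \<open>N\<close> and in the kernel
    of \<open>f\<close>, where \<open>l\<close> vanishes.\<close>
  moreover have "restrict l N x = restrict l N y"
    if xy: "x \<in> carrier (V\<lparr>carrier := N\<rparr>)" "y \<in> carrier (V\<lparr>carrier := N\<rparr>)"
      and eq: "restrict f N x = restrict f N y" for x y
  proof -
    have x: "x \<in> N" "x \<in> carrier V" and y: "y \<in> N" "y \<in> carrier V" using xy NV by auto
    have "f (x \<oplus>\<^bsub>V\<^esub> \<ominus>\<^bsub>V\<^esub> y) = \<zero>\<^bsub>A\<^esub>"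
      using x y eq V.hom_neg[OF A.M.abelian_group_axioms f] by (simp add: mod_homD[OF f] A.M.r_neg)
    moreover have "x \<oplus>\<^bsub>V\<^esub> \<ominus>\<^bsub>V\<^esub> y \<in> N" using x y Ns by blast
    ultimately have "l (x \<oplus>\<^bsub>V\<^esub> \<ominus>\<^bsub>V\<^esub> y) = \<zero>\<^bsub>Z\<^esub>" using 0 NV by blast
    then have "l x \<oplus>\<^bsub>Z\<^esub> \<ominus>\<^bsub>Z\<^esub> l y = \<zero>\<^bsub>Z\<^esub>"
      using x y V.hom_neg[OF Z.M.abelian_group_axioms l] by (simp add: mod_homD[OF l])
    then show ?thesis
      using x y mod_homD(2)[OF l] Z.M.minus_equality[of "l x" "\<ominus>\<^bsub>Z\<^esub> l y"] by simp
  qed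
  ultimately obtain h where h: "h \<in> mod_hom K (A\<lparr>carrier := f ` N\<rparr>) Z"
    "\<And>x. x \<in> carrier (V\<lparr>carrier := N\<rparr>) \<Longrightarrow> h (restrict f N x) = restrict l N x"
    using N.hom_factor[OF A.submodule_left_module[OF subI]] by blast
  obtain s where s: "s \<in> mod_hom K A Z" "\<And>x. x \<in> f ` N \<Longrightarrow> s x = h x"
    using injective_module_extend[OF inj A subI h(1)] by blast
  \<comment> \<open>With the negative of \<open>s\<close>, the sum of \<open>l\<close> and
    \<open>?s \<circ> f\<close> vanishes on \<open>N\<close>, so \<open>\<Psi>\<close> kills the
    sum; it kills the second term by assumption, hence also \<open>l\<close>.\<close>
  let ?s = "\<lambda>x\<in>carrier A. \<ominus>\<^bsub>Z\<^esub> s x"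
  have s': "?s \<in> mod_hom K A Z"
    by (rule mod_homI) (auto simp: mod_homD[OF s(1)] Z.smult_neg Z.M.minus_add Z.M.a_comm)
  have sf: "compose (carrier V) ?s f \<in> mod_hom K V Z" by (rule V.hom_compose[OF f s'])
  let ?m = "\<lambda>v\<in>carrier V. l v \<oplus>\<^bsub>Z\<^esub> compose (carrier V) ?s f v"
  have "?m \<in> mod_hom K V Z" by (rule module.hom_add[OF mod_Z mod_V l sf])
  moreover have "?m v = \<zero>\<^bsub>Z\<^esub>" if "v \<in> N" for v
    using that NV[OF that] s(2)[of "f v"] h(2)[of v] mod_homD(2)[OF l] mod_homD(2)[OF f]
    by (simp add: compose_def Z.M.r_neg)
  ultimately have "\<Psi> ?m = \<zero>\<^bsub>Z\<^esub>" using N by (simp add: supported_on_def)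
  then show "\<Psi> l = \<zero>\<^bsub>Z\<^esub>" using add[OF l sf] vanish[OF s'] closed[OF l] by simp
qed

text \<open>Starting from the whole of \<open>V\<close>, one kernel at a time is cut out with
  \<open>supported_on_kernel\<close>. Here it matters that a finitely related module has only
  finitely many generating relations.\<close>

lemma supported_on_kernels:
  fixes A :: "('r, 'a, 'b) module_scheme"
  assumes inj: "injective_module TYPE('r set) K Z" and A: "module K A" and "finite S"
    and f: "\<And>i. i \<in> S \<Longrightarrow> f i \<in> mod_hom K V A"
    and vanish: "\<And>i s. i \<in> S \<Longrightarrow> s \<in> mod_hom K A Z \<Longrightarrow> \<Psi> (compose (carrier V) s (f i)) = \<zero>\<^bsub>Z\<^esub>"
  shows "supported_on {v \<in> carrier V. \<forall>i\<in>S. f i v = \<zero>\<^bsub>A\<^esub>}"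
  using assms(3) f vanish
proof (induct S)
  case empty
  then show ?case using supported_on_carrier by simp
next
  case (insert i S)
  have "supported_on ({v \<in> carrier V. \<forall>i\<in>S. f i v = \<zero>\<^bsub>A\<^esub>} \<inter> {v \<in> carrier V. f i v = \<zero>\<^bsub>A\<^esub>})"
    using insert by (intro supported_on_kernel[OF inj _ A]) auto
  moreover have "{v \<in> carrier V. \<forall>i\<in>S. f i v = \<zero>\<^bsub>A\<^esub>} \<inter> {v \<in> carrier V. f i v = \<zero>\<^bsub>A\<^esub>} =
      {v \<in> carrier V. \<forall>j\<in>insert i S. f j v = \<zero>\<^bsub>A\<^esub>}" by auto
  ultimately show ?case by simp
qed

text \<open>Otherwise the class of \<open>\<Psi> b\<close> modulo b(N) is nonzero, and the
  cogenerator property yields an endomorphism \<open>t\<close> of \<open>Z\<close> that kills b(N)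
  but not \<open>\<Psi> b\<close>. Then \<open>t \<circ> b\<close> vanishes on \<open>N\<close>, so
  \<open>\<Psi>\<close> sends it to zero, whereas equivariance gives the value
  \<open>t (\<Psi> b)\<close>.\<close>

lemma attained:
  assumes cog: "cogenerator TYPE('z set) K Z" and N: "supported_on N" and b: "b \<in> mod_hom K V Z"
  shows "\<exists>v\<in>N. b v = \<Psi> b"
proof (rule ccontr)
  assume no: "\<not> (\<exists>v\<in>N. b v = \<Psi> b)"
  have subN: "submodule N K V" using N by (simp add: supported_on_def)
  then have NV: "N \<subseteq> carrier V" by (simp add: V.is_submodule_iff)
  have I: "submodule (b ` N) K Z" by (rule V.image_submodule[OF Z.left_module_axioms b subN])
  let ?Q = "quot_module Z (b ` N)"
  note Q = Z.quot_module[OF I]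
  interpret Q: left_module K ?Q by (rule Q(1))
  have mQ: "module K ?Q" using Q(1) mod_Z by (simp add: module_iff_left_module)
  have minus_0: "\<ominus>\<^bsub>Z\<^esub> \<zero>\<^bsub>Z\<^esub> = \<zero>\<^bsub>Z\<^esub>" by (rule Z.M.minus_equality) auto
  have "b ` N +>\<^bsub>Z\<^esub> \<Psi> b \<noteq> \<zero>\<^bsub>?Q\<^esub>"
    using no closed[OF b] by (auto simp: Q(4) Q(5) minus_0)
  moreover have "b ` N +>\<^bsub>Z\<^esub> \<Psi> b \<in> carrier ?Q" using closed[OF b] by (auto simp: Q(3))
  ultimately obtain x where x: "x \<in> mod_hom K ?Q Z" "x (b ` N +>\<^bsub>Z\<^esub> \<Psi> b) \<noteq> \<zero>\<^bsub>Z\<^esub>"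
    using cog mQ unfolding cogenerator_def by blast
  define t where "t = compose (carrier Z) x (\<lambda>z\<in>carrier Z. b ` N +>\<^bsub>Z\<^esub> z)"
  have t: "t \<in> mod_hom K Z Z" unfolding t_def by (rule Z.hom_compose[OF Q(2) x(1)])
  have "t (b v) = \<zero>\<^bsub>Z\<^esub>" if "v \<in> N" for v
  proof -
    have bv: "b v \<in> carrier Z" using that NV mod_homD(2)[OF b] by auto
    then have "b ` N +>\<^bsub>Z\<^esub> b v = \<zero>\<^bsub>?Q\<^esub>" using that by (simp add: Q(4) Q(5) minus_0)
    then show ?thesis
      using bv Q.hom_zero[OF Z.M.abelian_group_axioms x(1)] by (simp add: t_def compose_def)
  qed
  moreover have "compose (carrier V) t b \<in> mod_hom K V Z" by (rule V.hom_compose[OF b t])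
  ultimately have "\<Psi> (compose (carrier V) t b) = \<zero>\<^bsub>Z\<^esub>"
    using N NV by (auto simp: supported_on_def compose_def subset_iff)
  then have "t (\<Psi> b) = \<zero>\<^bsub>Z\<^esub>" using equivariant[OF b t] by simp
  then show False using x(2) closed[OF b] by (simp add: t_def compose_def)
qed

text \<open>A point \<open>v\<close> with the right value of \<open>b\<close> comes from
  \<open>attained\<close>. The value of \<open>b'\<close> is then corrected by adding a point
  \<open>u\<close> of \<open>N\<close> in the kernel of \<open>b\<close>, which leaves the first
  value unchanged.\<close>

lemma attained_pair:
  assumes inj: "injective_module TYPE('r set) K Z" and cog: "cogenerator TYPE('z set) K Z"
    and N: "supported_on N" and b: "b \<in> mod_hom K V Z" "b' \<in> mod_hom K V Z"
  shows "\<exists>v\<in>N. b v = \<Psi> b \<and> b' v = \<Psi> b'"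
proof -
  obtain v where v: "v \<in> N" "b v = \<Psi> b" using attained[OF cog N b(1)] by blast
  have NV: "N \<subseteq> carrier V" using N by (simp add: supported_on_def V.is_submodule_iff)
  then have vV: "v \<in> carrier V" using v by auto
  \<comment> \<open>Subtracting the evaluation at \<open>v\<close> leaves a functional supported on \<open>N \<inter> ker b\<close>.\<close>
  define \<Phi> where "\<Phi> = (\<lambda>l. \<Psi> l \<oplus>\<^bsub>Z\<^esub> \<ominus>\<^bsub>Z\<^esub> l v)"
  interpret \<Phi>: bidual_functional K V Z \<Phi>
  proof (rule bidual_functional.intro)
    fix l assume l: "l \<in> mod_hom K V Z"
    note lv = mod_homD(2)[OF l vV]
    show "\<Phi> l \<in> carrier Z" using l closed lv by (simp add: \<Phi>_def)
    show "\<Phi> (\<lambda>v\<in>carrier V. l v \<oplus>\<^bsub>Z\<^esub> l' v) = \<Phi> l \<oplus>\<^bsub>Z\<^esub> \<Phi> l'" if l': "l' \<in> mod_hom K V Z" for l'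
      using l' closed[OF l] closed[OF l'] add[OF l l'] lv mod_homD(2)[OF l' vV] vV
      by (simp add: \<Phi>_def Z.M.minus_add Z.M.a_ac)
    show "\<Phi> (compose (carrier V) t l) = t (\<Phi> l)" if t: "t \<in> mod_hom K Z Z" for t
      using closed[OF l] equivariant[OF l t] lv vV Z.hom_neg[OF Z.M.abelian_group_axioms t]
      by (simp add: \<Phi>_def compose_def mod_homD[OF t])
  qed (rule mod_V mod_Z)+
  \<comment> \<open>As \<open>v\<close> lies in \<open>N\<close>, evaluation at \<open>v\<close> is
    zero on functionals vanishing on \<open>N\<close>.\<close>
  have "\<Phi>.supported_on N"
    unfolding \<Phi>.supported_on_def
    using N v(1) by (auto simp: supported_on_def \<Phi>_def Z.M.r_neg)
  \<comment> \<open>\<open>\<Phi>\<close> kills every \<open>s \<circ> b\<close>: equivariance gives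
    \<open>\<Psi> (s \<circ> b) = s (\<Psi> b)\<close>, which is \<open>s (b v)\<close> by the
    choice of \<open>v\<close>.\<close>
  then have "\<Phi>.supported_on (N \<inter> {v \<in> carrier V. b v = \<zero>\<^bsub>Z\<^esub>})"
  proof (rule \<Phi>.supported_on_kernel[OF inj _ mod_Z b(1)])
    fix s assume s: "s \<in> mod_hom K Z Z"
    then show "\<Phi> (compose (carrier V) s b) = \<zero>\<^bsub>Z\<^esub>"
      using equivariant[OF b(1) s] v vV closed[OF b(1)] mod_homD(2)[OF s]
      by (simp add: \<Phi>_def compose_def Z.M.r_neg)
  qed
  then obtain u where u: "u \<in> N" "u \<in> carrier V" "b u = \<zero>\<^bsub>Z\<^esub>" "b' u = \<Phi> b'"
    using \<Phi>.attained[OF cog _ b(2)] by auto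
  show ?thesis
  proof (intro bexI conjI)
    show "v \<oplus>\<^bsub>V\<^esub> u \<in> N" using N u(1) v(1) by (simp add: supported_on_def V.is_submodule_iff)
    show "b (v \<oplus>\<^bsub>V\<^esub> u) = \<Psi> b"
      using u vV v closed[OF b(1)] by (simp add: mod_homD[OF b(1)])
    have "b' v \<oplus>\<^bsub>Z\<^esub> (\<Psi> b' \<oplus>\<^bsub>Z\<^esub> \<ominus>\<^bsub>Z\<^esub> b' v) = \<Psi> b'"
      using closed[OF b(2)] mod_homD(2)[OF b(2) vV] by (simp add: Z.M.a_ac Z.M.r_neg2 Z.M.r_neg)
    then show "b' (v \<oplus>\<^bsub>V\<^esub> u) = \<Psi> b'"
      using u vV by (simp add: mod_homD[OF b(2)] \<Phi>_def)
  qed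
qed

end

section \<open>Balanced pairings of a dual with a module\<close>

text \<open>For an \<open>R\<close>-homomorphism \<open>h\<close> from \<open>D\<close> to
  \<open>U\<close>, the pairing with value \<open>\<rho> (h d)\<close> at \<open>\<rho>\<close> and
  \<open>d\<close> satisfies all these conditions; they are what can be said before such an
  \<open>h\<close> is known.\<close>

locale balanced_pairing =
  fixes R :: "('r, 'q) ring_scheme" and C :: "'r set" and U :: "('r, 'u, 's) module_scheme"
    and Z :: "('r, 'z, 't) module_scheme" and D :: "('r, 'd, 'k) module_scheme"
    and B :: "('u \<Rightarrow> 'z) \<Rightarrow> 'd \<Rightarrow> 'z"
  assumes central: "central_subring C R"
    and mod_U: "left_module R U" and mod_Z: "module (R\<lparr>carrier := C\<rparr>) Z" and mod_D: "left_module R D"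
    and closed: "\<rho> \<in> mod_hom (R\<lparr>carrier := C\<rparr>) U Z \<Longrightarrow> d \<in> carrier D \<Longrightarrow> B \<rho> d \<in> carrier Z"
    and add_left: "\<rho> \<in> mod_hom (R\<lparr>carrier := C\<rparr>) U Z \<Longrightarrow> \<sigma> \<in> mod_hom (R\<lparr>carrier := C\<rparr>) U Z \<Longrightarrow>
      d \<in> carrier D \<Longrightarrow> B (\<lambda>u\<in>carrier U. \<rho> u \<oplus>\<^bsub>Z\<^esub> \<sigma> u) d = B \<rho> d \<oplus>\<^bsub>Z\<^esub> B \<sigma> d"
    and add_right: "\<rho> \<in> mod_hom (R\<lparr>carrier := C\<rparr>) U Z \<Longrightarrow> d \<in> carrier D \<Longrightarrow> e \<in> carrier D \<Longrightarrow>
      B \<rho> (d \<oplus>\<^bsub>D\<^esub> e) = B \<rho> d \<oplus>\<^bsub>Z\<^esub> B \<rho> e"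
    and equivariant: "\<rho> \<in> mod_hom (R\<lparr>carrier := C\<rparr>) U Z \<Longrightarrow> t \<in> mod_hom (R\<lparr>carrier := C\<rparr>) Z Z \<Longrightarrow>
      d \<in> carrier D \<Longrightarrow> B (compose (carrier U) t \<rho>) d = t (B \<rho> d)"
    and balanced: "\<rho> \<in> mod_hom (R\<lparr>carrier := C\<rparr>) U Z \<Longrightarrow> r \<in> carrier R \<Longrightarrow> d \<in> carrier D \<Longrightarrow>
      B (\<lambda>u\<in>carrier U. \<rho> (r \<odot>\<^bsub>U\<^esub> u)) d = B \<rho> (r \<odot>\<^bsub>D\<^esub> d)"
begin

abbreviation "K \<equiv> R\<lparr>carrier := C\<rparr>"

sublocale U: left_module R U by (rule mod_U)
sublocale D: left_module R D by (rule mod_D)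
sublocale Z: left_module K Z using mod_Z by (simp add: module_iff_left_module)

lemma mod_K_U: "module K U" by (rule restricted_module[OF mod_U central])

sublocale KU: left_module K U using mod_K_U by (simp add: module_iff_left_module)

lemma C_subset: "C \<subseteq> carrier R"
  using central subringE(1)[of C R] by (simp add: central_subring_def)

lemma B_zero:
  assumes "\<rho> \<in> mod_hom K U Z" shows "B \<rho> \<zero>\<^bsub>D\<^esub> = \<zero>\<^bsub>Z\<^esub>"
proof -
  have "(\<lambda>d\<in>carrier D. B \<rho> d) \<in> add_hom D Z"
    using closed[OF assms] add_right[OF assms] by (auto simp: add_hom_def)
  from add_hom_zero[OF D.M.abelian_group_axioms Z.M.abelian_group_axioms this]
  show ?thesis by simp
qed

text \<open>Since \<open>C\<close> is central, each \<open>r\<close> in \<open>R\<close> acts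
  \<open>C\<close>-linearly on \<open>U\<close>.\<close>

lemma smult_commute:
  "c \<in> C \<Longrightarrow> r \<in> carrier R \<Longrightarrow> u \<in> carrier U \<Longrightarrow> r \<odot>\<^bsub>U\<^esub> (c \<odot>\<^bsub>U\<^esub> u) = c \<odot>\<^bsub>U\<^esub> (r \<odot>\<^bsub>U\<^esub> u)"
  using central C_subset by (auto simp: central_subring_def subset_iff simp flip: U.smult_assoc1)

lemma smult_finsum:
  assumes "r \<in> carrier R" "h \<in> A \<rightarrow> carrier U"
  shows "r \<odot>\<^bsub>U\<^esub> finsum U h A = finsum U (\<lambda>a. r \<odot>\<^bsub>U\<^esub> h a) A"
proof -
  have "(\<lambda>u\<in>carrier U. r \<odot>\<^bsub>U\<^esub> u) \<in> add_hom U U"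
    using assms(1) by (auto simp: add_hom_def U.smult_r_distr)
  from add_hom_finsum[OF U.M.abelian_group_axioms U.M.abelian_group_axioms this assms(2)]
  have "r \<odot>\<^bsub>U\<^esub> finsum U h A = finsum U (\<lambda>a. (\<lambda>u\<in>carrier U. r \<odot>\<^bsub>U\<^esub> u) (h a)) A"
    using assms(2) by simp
  also have "\<dots> = finsum U (\<lambda>a. r \<odot>\<^bsub>U\<^esub> h a) A"
    using assms by (intro U.M.finsum_cong') auto
  finally show ?thesis .
qed

end

section \<open>Pairings with a free module\<close>

definition std_basis :: "('r, 'q) ring_scheme \<Rightarrow> 'x set \<Rightarrow> 'x \<Rightarrow> 'x \<Rightarrow> 'r" where
  "std_basis R X a = (\<lambda>x\<in>X. if x = a then \<one>\<^bsub>R\<^esub> else \<zero>\<^bsub>R\<^esub>)"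

lemma std_basis_closed: "ring R \<Longrightarrow> std_basis R X a \<in> carrier (free_module R X)"
proof -
  assume "ring R"
  then interpret ring R .
  have "finite {x \<in> X. std_basis R X a x \<noteq> \<zero>\<^bsub>R\<^esub>}"
    by (rule finite_subset[of _ "{a}"]) (auto simp: std_basis_def)
  then show ?thesis by (auto simp: free_module_def std_basis_def)
qed

text \<open>Homomorphisms from the free module to \<open>U\<close> that kill the generators outside
  \<open>Y\<close> correspond to points of the power of \<open>U\<close> over \<open>Y\<close>;
  finiteness of \<open>Y\<close> makes the sums below meaningful.\<close>

locale free_balanced_pairing = balanced_pairing R C U Z "free_module R X" B
  for R :: "('r, 'q) ring_scheme" and C U Z and X :: "'x set" and B +
  fixes Y
  assumes fin_Y: "finite Y" and Y_sub: "Y \<subseteq> X"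
begin

abbreviation "F \<equiv> free_module R X"
abbreviation "V \<equiv> power_module U Y"
abbreviation "e \<equiv> std_basis R X"

text \<open>The value at \<open>w\<close> of the homomorphism sending the generator at
  \<open>a\<close> in \<open>Y\<close> to \<open>v a\<close> and the generators outside
  \<open>Y\<close> to zero. It is studied as a function of \<open>v\<close> for fixed
  \<open>w\<close>, and of \<open>w\<close> for fixed \<open>v\<close>.\<close>

definition ev where "ev w = (\<lambda>v\<in>carrier V. \<Oplus>\<^bsub>U\<^esub>a\<in>Y. w a \<odot>\<^bsub>U\<^esub> v a)"

definition inj_at where "inj_at a u = (\<lambda>b\<in>Y. if b = a then u else \<zero>\<^bsub>U\<^esub>)"

text \<open>If \<open>B\<close> came from a homomorphism \<open>h\<close>, the point with
  coordinates \<open>h (e a)\<close> would have \<open>l\<close>-value equal to the sum of the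
  restrictions of \<open>l\<close> to the coordinates, each evaluated at \<open>h (e a)\<close>.
  Replacing these evaluations by \<open>B\<close> gives the formula.\<close>

definition \<Psi> where "\<Psi> l = (\<Oplus>\<^bsub>Z\<^esub>a\<in>Y. B (\<lambda>u\<in>carrier U. l (inj_at a u)) (e a))"

definition supp_Y where "supp_Y w \<longleftrightarrow> w \<in> carrier F \<and> (\<forall>x\<in>X - Y. w x = \<zero>\<^bsub>R\<^esub>)"

lemma e_closed [simp]: "e a \<in> carrier F"
  by (rule std_basis_closed[OF U.R.ring_axioms])

lemma F_coeff: "w \<in> carrier F \<Longrightarrow> a \<in> Y \<Longrightarrow> w a \<in> carrier R"
  using Y_sub by (auto simp: free_module_def)

lemma V_coeff: "v \<in> carrier V \<Longrightarrow> a \<in> Y \<Longrightarrow> v a \<in> carrier U"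
  by (auto simp: power_module_def)

lemma V_simps:
  "a \<in> Y \<Longrightarrow> (v \<oplus>\<^bsub>V\<^esub> v') a = v a \<oplus>\<^bsub>U\<^esub> v' a"
  "a \<in> Y \<Longrightarrow> (r \<odot>\<^bsub>V\<^esub> v) a = r \<odot>\<^bsub>U\<^esub> v a"
  by (auto simp: power_module_def)

lemma F_simps:
  "a \<in> X \<Longrightarrow> (w \<oplus>\<^bsub>F\<^esub> w') a = w a \<oplus>\<^bsub>R\<^esub> w' a"
  "a \<in> X \<Longrightarrow> (r \<odot>\<^bsub>F\<^esub> w) a = r \<otimes>\<^bsub>R\<^esub> w a"
  by (auto simp: free_module_def)

lemma mod_V: "module K V"
  using KU.power_module_left_module[of Y] mod_Z by (simp add: module_iff_left_module)

sublocale V: left_module K V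
  using mod_V by (simp add: module_iff_left_module)

lemma inj_at_closed: "u \<in> carrier U \<Longrightarrow> inj_at a u \<in> carrier V"
  by (auto simp: inj_at_def power_module_def)

lemma ev_apply: "v \<in> carrier V \<Longrightarrow> ev w v = (\<Oplus>\<^bsub>U\<^esub>a\<in>Y. w a \<odot>\<^bsub>U\<^esub> v a)"
  by (simp add: ev_def)

text \<open>In the variable \<open>v\<close> only \<open>C\<close>-linearity is available: scalars
  have to pass the coefficients \<open>w a\<close>, which central ones do.\<close>

lemma ev_hom:
  assumes w: "w \<in> carrier F" shows "ev w \<in> mod_hom K V U"
proof (rule mod_homI)
  note [simp] = F_coeff[OF w]
  fix v assume v: "v \<in> carrier V"
  note [simp] = V_coeff[OF v]
  show "ev w v \<in> carrier U" using v by (auto simp: ev_def)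
  show "ev w (v \<oplus>\<^bsub>V\<^esub> v') = ev w v \<oplus>\<^bsub>U\<^esub> ev w v'" if v': "v' \<in> carrier V" for v'
  proof -
    note [simp] = V_coeff[OF v']
    have "ev w (v \<oplus>\<^bsub>V\<^esub> v') = (\<Oplus>\<^bsub>U\<^esub>a\<in>Y. w a \<odot>\<^bsub>U\<^esub> v a \<oplus>\<^bsub>U\<^esub> w a \<odot>\<^bsub>U\<^esub> v' a)"
      unfolding ev_apply[OF V.M.a_closed[OF v v']]
      by (intro U.M.finsum_cong') (auto simp: V_simps U.smult_r_distr)
    also have "\<dots> = ev w v \<oplus>\<^bsub>U\<^esub> ev w v'"
      unfolding ev_apply[OF v] ev_apply[OF v'] by (rule U.M.finsum_addf, auto)
    finally show ?thesis .
  qed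
  show "ev w (r \<odot>\<^bsub>V\<^esub> v) = r \<odot>\<^bsub>U\<^esub> ev w v" if r: "r \<in> carrier K" for r
  proof -
    have r': "r \<in> C" "r \<in> carrier R" using r C_subset by auto
    have "ev w (r \<odot>\<^bsub>V\<^esub> v) = (\<Oplus>\<^bsub>U\<^esub>a\<in>Y. r \<odot>\<^bsub>U\<^esub> (w a \<odot>\<^bsub>U\<^esub> v a))"
      using r' unfolding ev_apply[OF V.smult_closed[OF r v]]
      by (intro U.M.finsum_cong') (auto simp: V_simps smult_commute)
    also have "\<dots> = r \<odot>\<^bsub>U\<^esub> ev w v"
      unfolding ev_apply[OF v] using r' by (intro smult_finsum[symmetric]) auto
    finally show ?thesis .
  qed
qed (simp add: ev_def)

text \<open>In the variable \<open>w\<close> the expression is \<open>R\<close>-linear, so a point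
  of \<open>V\<close> yields a homomorphism from the free module to \<open>U\<close>.\<close>

lemma ev_hom_F:
  assumes v: "v \<in> carrier V" shows "(\<lambda>w\<in>carrier F. ev w v) \<in> mod_hom R F U"
proof (rule mod_homI)
  note [simp] = V_coeff[OF v]
  fix w assume w: "w \<in> carrier F"
  note [simp] = F_coeff[OF w]
  show "(\<lambda>w\<in>carrier F. ev w v) w \<in> carrier U" using v w by (auto simp: ev_def)
  show "(\<lambda>w\<in>carrier F. ev w v) (w \<oplus>\<^bsub>F\<^esub> w') = (\<lambda>w\<in>carrier F. ev w v) w \<oplus>\<^bsub>U\<^esub> (\<lambda>w\<in>carrier F. ev w v) w'"
    if w': "w' \<in> carrier F" for w'
  proof -
    note [simp] = F_coeff[OF w']
    have "ev (w \<oplus>\<^bsub>F\<^esub> w') v = (\<Oplus>\<^bsub>U\<^esub>a\<in>Y. w a \<odot>\<^bsub>U\<^esub> v a \<oplus>\<^bsub>U\<^esub> w' a \<odot>\<^bsub>U\<^esub> v a)"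
      using Y_sub unfolding ev_apply[OF v]
      by (intro U.M.finsum_cong') (auto simp: F_simps subset_iff U.smult_l_distr)
    also have "\<dots> = ev w v \<oplus>\<^bsub>U\<^esub> ev w' v"
      unfolding ev_apply[OF v] by (rule U.M.finsum_addf, auto)
    finally show ?thesis using w w' by simp
  qed
  show "(\<lambda>w\<in>carrier F. ev w v) (r \<odot>\<^bsub>F\<^esub> w) = r \<odot>\<^bsub>U\<^esub> (\<lambda>w\<in>carrier F. ev w v) w" if r: "r \<in> carrier R" for r
  proof -
    have "ev (r \<odot>\<^bsub>F\<^esub> w) v = (\<Oplus>\<^bsub>U\<^esub>a\<in>Y. r \<odot>\<^bsub>U\<^esub> (w a \<odot>\<^bsub>U\<^esub> v a))"
      using r Y_sub unfolding ev_apply[OF v]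
      by (intro U.M.finsum_cong') (auto simp: F_simps subset_iff U.smult_assoc1)
    also have "\<dots> = r \<odot>\<^bsub>U\<^esub> ev w v"
      unfolding ev_apply[OF v] using r by (intro smult_finsum[symmetric]) auto
    finally show ?thesis using w r by simp
  qed
qed simp

lemma inj_at_add:
  "u \<in> carrier U \<Longrightarrow> u' \<in> carrier U \<Longrightarrow> inj_at a (u \<oplus>\<^bsub>U\<^esub> u') = inj_at a u \<oplus>\<^bsub>V\<^esub> inj_at a u'"
  by (auto simp: inj_at_def power_module_def)

lemma inj_at_smult: "r \<in> C \<Longrightarrow> u \<in> carrier U \<Longrightarrow> inj_at a (r \<odot>\<^bsub>U\<^esub> u) = r \<odot>\<^bsub>V\<^esub> inj_at a u"
  using KU.smult_zero_right by (auto simp: inj_at_def power_module_def)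

lemma restrict_inj_at_hom:
  assumes l: "l \<in> mod_hom K V Z" shows "(\<lambda>u\<in>carrier U. l (inj_at a u)) \<in> mod_hom K U Z"
proof (rule mod_homI)
  fix r u assume "r \<in> carrier K" "u \<in> carrier U"
  then show "(\<lambda>u\<in>carrier U. l (inj_at a u)) (r \<odot>\<^bsub>U\<^esub> u) = r \<odot>\<^bsub>Z\<^esub> (\<lambda>u\<in>carrier U. l (inj_at a u)) u"
    using mod_homD(4)[OF l, of r "inj_at a u"] KU.smult_closed[of r u]
    by (simp add: inj_at_smult inj_at_closed)
qed (auto simp: inj_at_add inj_at_closed mod_homD[OF l])

text \<open>Restricting \<open>l\<close> to a coordinate commutes with sums and with postcomposition
  by \<open>t\<close>, so additivity and equivariance of \<open>B\<close> in its first argument pass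
  to the finite sum \<open>\<Psi>\<close>.\<close>

lemma bidual: "bidual_functional K V Z \<Psi>"
proof (rule bidual_functional.intro[OF mod_V mod_Z])
  fix l assume l: "l \<in> mod_hom K V Z"
  note L = restrict_inj_at_hom[OF l]
  show "\<Psi> l \<in> carrier Z" using closed[OF L] by (auto simp: \<Psi>_def)
  show "\<Psi> (\<lambda>v\<in>carrier V. l v \<oplus>\<^bsub>Z\<^esub> l' v) = \<Psi> l \<oplus>\<^bsub>Z\<^esub> \<Psi> l'" if l': "l' \<in> mod_hom K V Z" for l'
  proof -
    note L' = restrict_inj_at_hom[OF l']
    have "(\<lambda>u\<in>carrier U. (\<lambda>v\<in>carrier V. l v \<oplus>\<^bsub>Z\<^esub> l' v) (inj_at a u)) =
        (\<lambda>u\<in>carrier U. (\<lambda>u\<in>carrier U. l (inj_at a u)) u \<oplus>\<^bsub>Z\<^esub> (\<lambda>u\<in>carrier U. l' (inj_at a u)) u)" for a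
      by (auto simp: inj_at_closed intro!: restrict_ext)
    then have "\<Psi> (\<lambda>v\<in>carrier V. l v \<oplus>\<^bsub>Z\<^esub> l' v) = (\<Oplus>\<^bsub>Z\<^esub>a\<in>Y.
        B (\<lambda>u\<in>carrier U. l (inj_at a u)) (e a) \<oplus>\<^bsub>Z\<^esub> B (\<lambda>u\<in>carrier U. l' (inj_at a u)) (e a))"
      by (simp only: \<Psi>_def add_left[OF L L' e_closed])
    also have "\<dots> = \<Psi> l \<oplus>\<^bsub>Z\<^esub> \<Psi> l'"
      unfolding \<Psi>_def by (rule Z.M.finsum_addf) (use closed[OF L] closed[OF L'] in auto)
    finally show ?thesis .
  qed
  show "\<Psi> (compose (carrier V) t l) = t (\<Psi> l)" if t: "t \<in> mod_hom K Z Z" for t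
  proof -
    have "(\<lambda>u\<in>carrier U. compose (carrier V) t l (inj_at a u)) =
        compose (carrier U) t (\<lambda>u\<in>carrier U. l (inj_at a u))" for a
      by (auto simp: inj_at_closed compose_def intro!: restrict_ext)
    then have "\<Psi> (compose (carrier V) t l) = (\<Oplus>\<^bsub>Z\<^esub>a\<in>Y. t (B (\<lambda>u\<in>carrier U. l (inj_at a u)) (e a)))"
      by (simp only: \<Psi>_def equivariant[OF L t e_closed])
    also have "\<dots> = t (\<Psi> l)"
      unfolding \<Psi>_def
      by (rule add_hom_finsum[OF Z.M.abelian_group_axioms Z.M.abelian_group_axioms
            mod_hom_add_hom[OF t], symmetric]) (use closed[OF L] in auto)
    finally show ?thesis .
  qed
qed

lemma B_decompose:
  assumes \<rho>: "\<rho> \<in> mod_hom K U Z" and w: "supp_Y w"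
  shows "B \<rho> w = (\<Oplus>\<^bsub>Z\<^esub>a\<in>Y. B \<rho> (w a \<odot>\<^bsub>F\<^esub> e a))"
proof -
  have "w \<in> carrier F \<Longrightarrow> \<forall>x\<in>X - Y'. w x = \<zero>\<^bsub>R\<^esub> \<Longrightarrow>
      B \<rho> w = (\<Oplus>\<^bsub>Z\<^esub>a\<in>Y'. B \<rho> (w a \<odot>\<^bsub>F\<^esub> e a))" if "finite Y'" "Y' \<subseteq> X" for Y' w
    using that
  proof (induct Y' arbitrary: w)
    case empty
    have "w = \<zero>\<^bsub>F\<^esub>"
      by (rule extensionalityI[of _ X]) (use empty in \<open>auto simp: free_module_def PiE_iff\<close>)
    then show ?case using B_zero[OF \<rho>] by simp
  next
    case (insert a Y')
    \<comment> \<open>The coordinate at \<open>a\<close> is split off: \<open>w'\<close> vanishes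
      outside \<open>Y'\<close>, and \<open>w\<close> is the sum of \<open>w'\<close> and
      \<open>w a\<close> times the generator at \<open>a\<close>.\<close>
    define w' where "w' = w(a := \<zero>\<^bsub>R\<^esub>)"
    have wX: "w x \<in> carrier R" if "x \<in> X" for x
      using insert(4) that by (auto simp: free_module_def)
    have a: "a \<in> X" using insert(6) by simp
    have "finite {x \<in> X. w' x \<noteq> \<zero>\<^bsub>R\<^esub>}"
      by (rule finite_subset[of _ "{x \<in> X. w x \<noteq> \<zero>\<^bsub>R\<^esub>}"])
        (use insert(4) in \<open>auto simp: w'_def free_module_def\<close>)
    then have w': "w' \<in> carrier F"
      using insert(4) a by (auto simp: w'_def free_module_def PiE_iff extensional_def)
    have wa: "w a \<odot>\<^bsub>F\<^esub> e a \<in> carrier F" using wX[OF a] by simp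
    have "w = w' \<oplus>\<^bsub>F\<^esub> w a \<odot>\<^bsub>F\<^esub> e a"
    proof (rule extensionalityI[of _ X])
      show "w \<in> extensional X" using insert(4) by (auto simp: free_module_def PiE_iff)
      show "w' \<oplus>\<^bsub>F\<^esub> w a \<odot>\<^bsub>F\<^esub> e a \<in> extensional X" by (simp add: free_module_def)
      show "w x = (w' \<oplus>\<^bsub>F\<^esub> w a \<odot>\<^bsub>F\<^esub> e a) x" if "x \<in> X" for x
        using that a wX by (auto simp: F_simps w'_def std_basis_def)
    qed
    then have "B \<rho> w = B \<rho> w' \<oplus>\<^bsub>Z\<^esub> B \<rho> (w a \<odot>\<^bsub>F\<^esub> e a)"
      using add_right[OF \<rho> w' wa] by simp
    also have "B \<rho> w' = (\<Oplus>\<^bsub>Z\<^esub>b\<in>Y'. B \<rho> (w' b \<odot>\<^bsub>F\<^esub> e b))"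
      using insert(6,5) w' by (intro insert(3)[OF w']) (auto simp: w'_def)
    also have "\<dots> = (\<Oplus>\<^bsub>Z\<^esub>b\<in>Y'. B \<rho> (w b \<odot>\<^bsub>F\<^esub> e b))"
      using insert(2,6) wX closed[OF \<rho>]
      by (intro Z.M.finsum_cong') (auto simp: w'_def subset_iff)
    also have "\<dots> \<oplus>\<^bsub>Z\<^esub> B \<rho> (w a \<odot>\<^bsub>F\<^esub> e a) = (\<Oplus>\<^bsub>Z\<^esub>b\<in>insert a Y'. B \<rho> (w b \<odot>\<^bsub>F\<^esub> e b))"
      using insert(1,2,6) wX closed[OF \<rho>] wa
      by (subst Z.M.finsum_insert) (auto simp: subset_iff intro!: Z.M.a_comm)
    finally show ?case .
  qed
  from this[OF fin_Y Y_sub] show ?thesis using w by (auto simp: supp_Y_def)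
qed

text \<open>On the coordinate \<open>a\<close>, the functional \<open>\<rho> \<circ> ev w\<close> is
  \<open>u \<mapsto> \<rho> (w a u)\<close>. Balancedness moves \<open>w a\<close> over to the
  generator, and \<open>B_decompose\<close> reassembles \<open>w\<close>.\<close>

lemma \<Psi>_ev:
  assumes \<rho>: "\<rho> \<in> mod_hom K U Z" and w: "supp_Y w"
  shows "\<Psi> (compose (carrier V) \<rho> (ev w)) = B \<rho> w"
proof -
  have wF: "w \<in> carrier F" using w by (simp add: supp_Y_def)
  have eq: "(\<lambda>u\<in>carrier U. compose (carrier V) \<rho> (ev w) (inj_at a u)) =
      (\<lambda>u\<in>carrier U. \<rho> (w a \<odot>\<^bsub>U\<^esub> u))" if a: "a \<in> Y" for a
  proof (rule restrict_ext)
    fix u assume u: "u \<in> carrier U"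
    have "ev w (inj_at a u) = (\<Oplus>\<^bsub>U\<^esub>b\<in>Y. w b \<odot>\<^bsub>U\<^esub> inj_at a u b)"
      using inj_at_closed[OF u] by (simp add: ev_def)
    also have "\<dots> = (\<Oplus>\<^bsub>U\<^esub>b\<in>Y. if a = b then w b \<odot>\<^bsub>U\<^esub> u else \<zero>\<^bsub>U\<^esub>)"
      using F_coeff[OF wF] u
      by (intro U.M.finsum_cong') (auto simp: inj_at_def U.smult_zero_right)
    also have "\<dots> = w a \<odot>\<^bsub>U\<^esub> u"
      using F_coeff[OF wF] u a fin_Y by (intro U.M.finsum_singleton) auto
    finally show "compose (carrier V) \<rho> (ev w) (inj_at a u) = \<rho> (w a \<odot>\<^bsub>U\<^esub> u)"
      using inj_at_closed[OF u] by (simp add: compose_def)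
  qed
  have "\<Psi> (compose (carrier V) \<rho> (ev w)) = (\<Oplus>\<^bsub>Z\<^esub>a\<in>Y. B \<rho> (w a \<odot>\<^bsub>F\<^esub> e a))"
    unfolding \<Psi>_def
  proof (intro Z.M.finsum_cong')
    show "B (\<lambda>u\<in>carrier U. compose (carrier V) \<rho> (ev w) (inj_at a u)) (e a) = B \<rho> (w a \<odot>\<^bsub>F\<^esub> e a)"
      if "a \<in> Y" for a
      using balanced[OF \<rho> F_coeff[OF wF that] e_closed] by (simp add: eq[OF that])
  qed (use closed[OF \<rho>] F_coeff[OF wF] in auto)
  then show ?thesis using B_decompose[OF \<rho> w] by simp
qed

text \<open>By \<open>\<Psi>_ev\<close> the relations in \<open>S\<close> make \<open>\<Psi>\<close>
  vanish on every \<open>\<sigma> \<circ> ev s\<close>, so \<open>\<Psi>\<close> is supported on the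
  common kernel of the maps \<open>ev s\<close>. A point \<open>v\<close> there with the two
  prescribed values gives the homomorphism \<open>w \<mapsto> ev w v\<close>.\<close>

lemma free_interpolation:
  assumes inj: "injective_module TYPE('r set) K Z" and cog: "cogenerator TYPE('r set) K Z"
    and S: "finite S" "\<And>s. s \<in> S \<Longrightarrow> supp_Y s"
      "\<And>\<sigma> s. \<sigma> \<in> mod_hom K U Z \<Longrightarrow> s \<in> S \<Longrightarrow> B \<sigma> s = \<zero>\<^bsub>Z\<^esub>"
    and \<rho>: "\<rho> \<in> mod_hom K U Z" "\<rho>' \<in> mod_hom K U Z" and w: "supp_Y w" "supp_Y w'"
  obtains h where "h \<in> mod_hom R F U" "\<And>s. s \<in> S \<Longrightarrow> h s = \<zero>\<^bsub>U\<^esub>"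
    "\<rho> (h w) = B \<rho> w" "\<rho>' (h w') = B \<rho>' w'"
proof -
  interpret bidual_functional K V Z \<Psi> by (rule bidual)
  have car: "s \<in> S \<Longrightarrow> s \<in> carrier F" "w \<in> carrier F" "w' \<in> carrier F" for s
    using S(2) w by (auto simp: supp_Y_def)
  have "supported_on {v \<in> carrier V. \<forall>s\<in>S. ev s v = \<zero>\<^bsub>U\<^esub>}"
    by (rule supported_on_kernels[OF inj mod_K_U S(1)])
      (use S car in \<open>auto simp: ev_hom \<Psi>_ev\<close>)
  \<comment> \<open>The cogenerator property is moved to sets of elements of \<open>Z\<close>,
    because the quotient of \<open>Z\<close> to which it is applied consists of cosets.\<close>
  from attained_pair[OF inj cogenerator_universe[OF inj cog] this
      V.hom_compose[OF ev_hom[OF car(2)] \<rho>(1)] V.hom_compose[OF ev_hom[OF car(3)] \<rho>(2)]]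
  obtain v where v: "v \<in> carrier V" "\<forall>s\<in>S. ev s v = \<zero>\<^bsub>U\<^esub>"
    and "compose (carrier V) \<rho> (ev w) v = \<Psi> (compose (carrier V) \<rho> (ev w))"
      "compose (carrier V) \<rho>' (ev w') v = \<Psi> (compose (carrier V) \<rho>' (ev w'))"
    by blast
  then have "\<rho> (ev w v) = B \<rho> w" "\<rho>' (ev w' v) = B \<rho>' w'"
    unfolding \<Psi>_ev[OF \<rho>(1) w(1)] \<Psi>_ev[OF \<rho>(2) w(2)] by (simp_all add: compose_eq)
  then show thesis
    by (intro that[OF ev_hom_F[OF v(1)]]) (use v car in auto)
qed

end

text \<open>The pairing is pulled back along a presentation of \<open>D\<close>. The relations then
  pair to zero with everything, and the homomorphism found on the free module kills them, so it
  descends to \<open>D\<close>.\<close>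

lemma (in balanced_pairing) interpolation:
  assumes inj: "injective_module TYPE('r set) K Z" and cog: "cogenerator TYPE('r set) K Z"
    and fr: "finitely_related TYPE('x) R D"
    and \<rho>: "\<rho> \<in> mod_hom K U Z" "\<rho>' \<in> mod_hom K U Z" and d: "d \<in> carrier D" "d' \<in> carrier D"
  obtains h where "h \<in> mod_hom R D U" "\<rho> (h d) = B \<rho> d" "\<rho>' (h d') = B \<rho>' d'"
proof -
  from fr obtain X :: "'x set" and N where N: "fg_submodule N R (free_module R X)"
    and iso: "mod_iso R D (quot_module (free_module R X) N)"
    by (auto simp: finitely_related_def)
  let ?F = "free_module R X" and ?Q = "quot_module (free_module R X) N"
  interpret F: left_module R ?F by (rule free_module_left_module[OF U.R.ring_axioms])
  obtain S where S: "finite S" "S \<subseteq> carrier ?F" "N = submodule_span R ?F S"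
    using N by (auto simp: fg_submodule_def)
  have subN: "submodule N R ?F" unfolding S(3) by (rule F.span_submodule[OF S(2)])
  note Q = F.quot_module[OF subN]
  interpret Q: left_module R ?Q by (rule Q(1))
  obtain m where m: "m \<in> mod_hom R D ?Q" "bij_betw m (carrier D) (carrier ?Q)"
    using iso by (auto simp: mod_iso_def)
  obtain g where g: "g \<in> mod_hom R ?Q D" "\<And>x. x \<in> carrier D \<Longrightarrow> g (m x) = x"
    "\<And>y. y \<in> carrier ?Q \<Longrightarrow> m (g y) = y"
    using D.bij_hom_inverse[OF m] by blast
  \<comment> \<open>The presentation map: the quotient map followed by the inverse of the
    isomorphism \<open>m\<close>.\<close>
  define p where "p = compose (carrier ?F) g (\<lambda>x\<in>carrier ?F. N +>\<^bsub>?F\<^esub> x)"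
  have p: "p \<in> mod_hom R ?F D" unfolding p_def by (rule F.hom_compose[OF Q(2) g(1)])
  note P = mod_homD[OF p]
  have p_eq: "p x = g (N +>\<^bsub>?F\<^esub> x)" if "x \<in> carrier ?F" for x
    using that by (simp add: p_def compose_def)
  have surj: "\<exists>x\<in>carrier ?F. p x = y" if "y \<in> carrier D" for y
    using mod_homD(2)[OF m(1) that] g(2)[OF that] p_eq by (auto simp: Q(3))
  have p_ker: "x \<oplus>\<^bsub>?F\<^esub> \<ominus>\<^bsub>?F\<^esub> y \<in> N" if xy: "x \<in> carrier ?F" "y \<in> carrier ?F" "p x = p y" for x y
  proof -
    have "m (p x) = m (p y)" using xy(3) by simp
    then have "N +>\<^bsub>?F\<^esub> x = N +>\<^bsub>?F\<^esub> y" using xy(1,2) g(3) by (simp add: p_eq Q(3))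
    then show ?thesis using xy(1,2) Q(5) by blast
  qed
  have p_N: "p x = \<zero>\<^bsub>D\<^esub>" if x: "x \<in> N" for x
  proof -
    have xF: "x \<in> carrier ?F" using x subN by (auto simp: F.is_submodule_iff)
    have minus_0: "\<ominus>\<^bsub>?F\<^esub> \<zero>\<^bsub>?F\<^esub> = \<zero>\<^bsub>?F\<^esub>" by (rule F.M.minus_equality) auto
    have "N +>\<^bsub>?F\<^esub> x = \<zero>\<^bsub>?Q\<^esub>"
      using x xF Q(5)[OF xF F.M.zero_closed] by (simp add: Q(4) minus_0)
    then show ?thesis
      using xF Q.hom_zero[OF D.M.abelian_group_axioms g(1)] by (simp add: p_eq)
  qed
  obtain w w' where w: "w \<in> carrier ?F" "p w = d" "w' \<in> carrier ?F" "p w' = d'"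
    using surj[OF d(1)] surj[OF d(2)] by blast
  \<comment> \<open>All generators occurring in the two lifts or in the generating relations; there
    are finitely many, even if \<open>X\<close> is infinite.\<close>
  define Y where "Y = (\<Union>f\<in>insert w (insert w' S). {x \<in> X. f x \<noteq> \<zero>\<^bsub>R\<^esub>})"
  define B' where "B' = (\<lambda>\<rho> w. B \<rho> (p w))"
  have fin: "finite {x \<in> X. f x \<noteq> \<zero>\<^bsub>R\<^esub>}" if "f \<in> carrier ?F" for f
    using that by (simp add: free_module_def)
  then have finY: "finite Y" using w S(1,2) fin by (auto simp: Y_def)
  interpret FB: free_balanced_pairing R C U Z X B' Y
    by (intro free_balanced_pairing.intro free_balanced_pairing_axioms.intro balanced_pairing.intro
        central mod_U mod_Z F.left_module_axioms finY)
      (auto simp: B'_def Y_def P closed add_left add_right equivariant balanced)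
  have sup: "FB.supp_Y f" if "f \<in> insert w (insert w' S)" for f
    unfolding FB.supp_Y_def using that w S(2) by (auto simp: Y_def)
  have BS: "B' \<sigma> s = \<zero>\<^bsub>Z\<^esub>" if \<sigma>: "\<sigma> \<in> mod_hom K U Z" and "s \<in> S" for \<sigma> s
  proof -
    have "p s = \<zero>\<^bsub>D\<^esub>" using p_N that(2) F.span_superset S(3) by blast
    then show ?thesis using B_zero[OF \<sigma>] by (simp add: B'_def)
  qed
  obtain h where h: "h \<in> mod_hom R ?F U" "\<And>s. s \<in> S \<Longrightarrow> h s = \<zero>\<^bsub>U\<^esub>"
    "\<rho> (h w) = B' \<rho> w" "\<rho>' (h w') = B' \<rho>' w'"
    using FB.free_interpolation[OF inj cog S(1) _ BS \<rho>] sup by blast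
  \<comment> \<open>The kernel of \<open>h\<close> is a submodule containing the generators
    \<open>S\<close> of \<open>N\<close>.\<close>
  have "N \<subseteq> {x \<in> carrier ?F. h x = \<zero>\<^bsub>U\<^esub>}"
    unfolding S(3) using S(2) h(2)
    by (intro F.span_least F.kernel_submodule[OF mod_U h(1)]) auto
  then have hN: "x \<in> N \<Longrightarrow> h x = \<zero>\<^bsub>U\<^esub>" for x by blast
  have ker: "h x = h y" if xy: "x \<in> carrier ?F" "y \<in> carrier ?F" "p x = p y" for x y
  proof -
    have "h x \<oplus>\<^bsub>U\<^esub> \<ominus>\<^bsub>U\<^esub> h y = \<zero>\<^bsub>U\<^esub>"
      using hN[OF p_ker[OF xy]] xy F.hom_neg[OF U.M.abelian_group_axioms h(1)]
      by (simp add: mod_homD[OF h(1)])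
    then show ?thesis
      using xy mod_homD(2)[OF h(1)] U.M.minus_equality[of "h x" "\<ominus>\<^bsub>U\<^esub> h y"] by simp
  qed
  have "p ` carrier ?F = carrier D" using surj P(2) by (auto simp: image_iff)
  from F.hom_factor[OF mod_D p this h(1) ker]
  obtain k where k: "k \<in> mod_hom R D U" "\<And>x. x \<in> carrier ?F \<Longrightarrow> k (p x) = h x" by blast
  show thesis
    by (rule that[OF k(1)]) (use k(2)[OF w(1)] k(2)[OF w(3)] w h(3,4) in \<open>simp_all add: B'_def\<close>)
qed

section \<open>Endomorphisms of the dual\<close>

text \<open>The endomorphism is built by embedding \<open>U\<close> in the ambient module
  \<open>W\<close>, projecting to a finitely related summand \<open>D\<close>, and mapping
  \<open>D\<close> back to \<open>U\<close> by \<open>interpolation\<close>.\<close>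

lemma dual_End_interpolation:
  fixes R :: "('r, 'q) ring_scheme" and C :: "'r set" and U :: "('r, 'u, 's) module_scheme"
    and Z :: "('r, 'z, 't) module_scheme"
  defines "K \<equiv> R\<lparr>carrier := C\<rparr>"
  assumes C: "central_subring C R" and U: "left_module R U"
    and frcp: "FRCP TYPE('x) TYPE('w) R U"
    and inj: "injective_module TYPE('r set) K Z" and cog: "cogenerator TYPE('r set) K Z"
    and \<phi>: "\<phi> \<in> dual_bimodule_End R K U Z"
    and \<rho>: "\<rho> \<in> mod_hom K U Z" "\<rho>' \<in> mod_hom K U Z" and u: "u \<in> carrier U" "u' \<in> carrier U"
  obtains f where "f \<in> mod_hom R U U" "\<rho> (f u) = \<phi> \<rho> u" "\<rho>' (f u') = \<phi> \<rho>' u'"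
proof -
  interpret U: left_module R U by (rule U)
  have Z: "module K Z" using inj by (simp add: injective_module_def)
  from frcp[unfolded FRCP_def] obtain W :: "('r, 'w) module" where "left_module R W \<and>
      (\<exists>D. direct_summand D R W \<and> mod_iso R U (W\<lparr>carrier := D\<rparr>)) \<and>
      (\<forall>F. finite F \<and> F \<subseteq> carrier W \<longrightarrow>
        (\<exists>D. F \<subseteq> D \<and> direct_summand D R W \<and> finitely_related TYPE('x) R (W\<lparr>carrier := D\<rparr>)))" ..
  then have W: "left_module R W"
    and summand: "\<exists>D. direct_summand D R W \<and> mod_iso R U (W\<lparr>carrier := D\<rparr>)"
    and fr: "\<forall>F. finite F \<and> F \<subseteq> carrier W \<longrightarrow>
      (\<exists>D. F \<subseteq> D \<and> direct_summand D R W \<and> finitely_related TYPE('x) R (W\<lparr>carrier := D\<rparr>))"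
    by simp_all
  from summand obtain D0 where D0: "direct_summand D0 R W" and iso: "mod_iso R U (W\<lparr>carrier := D0\<rparr>)"
    by (elim exE conjE)
  interpret W: left_module R W by (rule W)
  obtain q0 where q0: "q0 \<in> mod_hom R W (W\<lparr>carrier := D0\<rparr>)" "\<And>d. d \<in> D0 \<Longrightarrow> q0 d = d"
    using W.direct_summand_projection[OF D0] by blast
  obtain i where i: "i \<in> mod_hom R U (W\<lparr>carrier := D0\<rparr>)"
    "bij_betw i (carrier U) (carrier (W\<lparr>carrier := D0\<rparr>))"
    using iso unfolding mod_iso_def by blast
  obtain j where j: "j \<in> mod_hom R (W\<lparr>carrier := D0\<rparr>) U" "\<And>x. x \<in> carrier U \<Longrightarrow> j (i x) = x"
    by (rule U.bij_hom_inverse[OF i]) (rule that)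
  \<comment> \<open>A retraction of \<open>W\<close> onto \<open>U\<close>, left inverse to the
    embedding \<open>i\<close>.\<close>
  define p where "p = compose (carrier W) j q0"
  have p: "p \<in> mod_hom R W U" unfolding p_def by (rule W.hom_compose[OF q0(1) j(1)])
  have D0W: "D0 \<subseteq> carrier W" using D0 by (simp add: direct_summand_def W.is_submodule_iff)
  have iD0: "i x \<in> D0" if "x \<in> carrier U" for x using mod_homD(2)[OF i(1) that] by simp
  have iW: "i x \<in> carrier W" if "x \<in> carrier U" for x using iD0[OF that] D0W by blast
  have i': "i \<in> mod_hom R U W"
    by (rule mod_homI) (use iW mod_homD[OF i(1)] in auto)
  have pi: "p (i x) = x" if "x \<in> carrier U" for x
    using q0(2)[OF iD0[OF that]] j(2)[OF that] iW[OF that] by (simp add: p_def compose_eq)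
  \<comment> \<open>Only the two points at which values are prescribed have to lie in the
    summand.\<close>
  obtain D where D: "{i u, i u'} \<subseteq> D" "direct_summand D R W"
    "finitely_related TYPE('x) R (W\<lparr>carrier := D\<rparr>)"
    using fr[rule_format, of "{i u, i u'}"] iW u by auto
  have subD: "submodule D R W" using D(2) by (simp add: direct_summand_def)
  then have DW: "x \<in> D \<Longrightarrow> x \<in> carrier W" for x by (auto simp: W.is_submodule_iff)
  obtain q where q: "q \<in> mod_hom R W (W\<lparr>carrier := D\<rparr>)" "\<And>d. d \<in> D \<Longrightarrow> q d = d"
    using W.direct_summand_projection[OF D(2)] by blast
  note P = mod_homD[OF p]
  from \<phi> have \<phi>l: "\<phi> \<in> mod_hom (End_ring K Z) (dual_left K U Z) (dual_left K U Z)"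
    and \<phi>r: "\<phi> \<in> mod_hom R (dual_right K U Z) (dual_right K U Z)"
    by (auto simp: dual_bimodule_End_def)
  note L = mod_homD[OF \<phi>l, unfolded dual_simps] and Rr = mod_homD[OF \<phi>r, unfolded dual_simps]
  have eq: "\<phi> (compose (carrier U) t \<sigma>) = compose (carrier U) t (\<phi> \<sigma>)"
    if "\<sigma> \<in> mod_hom K U Z" "t \<in> mod_hom K Z Z" for \<sigma> t
    using L(4)[of t \<sigma>] that by (simp add: End_ring_def)
  \<comment> \<open>Equivariance is the \<open>C'\<close>-linearity of \<open>\<phi>\<close>;
    balancedness is its \<open>R\<close>-linearity combined with that of \<open>p\<close>.\<close>
  interpret balanced_pairing R C U Z "W\<lparr>carrier := D\<rparr>" "\<lambda>\<rho> d. \<phi> \<rho> (p d)"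
  proof (rule balanced_pairing.intro; (fold K_def)?)
    show "left_module R (W\<lparr>carrier := D\<rparr>)" by (rule W.submodule_left_module[OF subD])
  next
    fix \<sigma> d assume \<sigma>: "\<sigma> \<in> mod_hom K U Z" and "d \<in> carrier (W\<lparr>carrier := D\<rparr>)"
    then have d: "d \<in> carrier W" "p d \<in> carrier U" using DW P(2) by auto
    note \<phi>\<sigma> = mod_homD[OF L(2)[OF \<sigma>]]
    show "\<phi> \<sigma> (p d) \<in> carrier Z" using \<phi>\<sigma>(2) d by simp
    show "\<phi> (\<lambda>u\<in>carrier U. \<sigma> u \<oplus>\<^bsub>Z\<^esub> \<tau> u) (p d) = \<phi> \<sigma> (p d) \<oplus>\<^bsub>Z\<^esub> \<phi> \<tau> (p d)"
      if "\<tau> \<in> mod_hom K U Z" for \<tau>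
      using L(3)[OF \<sigma> that] d by simp
    show "\<phi> \<sigma> (p (d \<oplus>\<^bsub>W\<lparr>carrier := D\<rparr>\<^esub> d')) = \<phi> \<sigma> (p d) \<oplus>\<^bsub>Z\<^esub> \<phi> \<sigma> (p d')"
      if "d' \<in> carrier (W\<lparr>carrier := D\<rparr>)" for d'
      using d that DW by (simp add: P \<phi>\<sigma>)
    show "\<phi> (compose (carrier U) t \<sigma>) (p d) = t (\<phi> \<sigma> (p d))" if "t \<in> mod_hom K Z Z" for t
      using eq[OF \<sigma> that] d by (simp add: compose_eq)
    show "\<phi> (\<lambda>u\<in>carrier U. \<sigma> (r \<odot>\<^bsub>U\<^esub> u)) (p d) = \<phi> \<sigma> (p (r \<odot>\<^bsub>W\<lparr>carrier := D\<rparr>\<^esub> d))"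
      if "r \<in> carrier R" for r
      using Rr(4)[OF that \<sigma>] d that by (simp add: P)
  qed (rule C U Z)+
  obtain h where h: "h \<in> mod_hom R (W\<lparr>carrier := D\<rparr>) U"
    "\<rho> (h (i u)) = \<phi> \<rho> (p (i u))" "\<rho>' (h (i u')) = \<phi> \<rho>' (p (i u'))"
    using interpolation[folded K_def, OF inj cog D(3) \<rho>, of "i u" "i u'"] D(1) by auto
  \<comment> \<open>The projection \<open>q\<close> fixes \<open>i u\<close> and
    \<open>i u'\<close>, so \<open>f\<close> takes the values of \<open>h\<close> there;
    \<open>p\<close> brings these two points back to \<open>u\<close> and \<open>u'\<close>.\<close>
  define f where "f = compose (carrier U) (compose (carrier W) h q) i"
  have "f \<in> mod_hom R U U"
    unfolding f_def by (rule U.hom_compose[OF i' W.hom_compose[OF q(1) h(1)]])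
  moreover have "f u = h (i u)" "f u' = h (i u')"
    using u iW q(2) D(1) by (simp_all add: f_def compose_eq)
  ultimately show thesis using that h(2,3) u pi by simp
qed

text \<open>Multiplication by an element of the central subring is an \<open>R\<close>-endomorphism
  of \<open>U\<close>, and \<open>g\<close> commutes with all of those.\<close>

lemma Biend_mod_hom:
  assumes C: "central_subring C R" and U: "left_module R U" and g: "g \<in> Biend R U"
  shows "g \<in> mod_hom (R\<lparr>carrier := C\<rparr>) U U"
proof -
  interpret U: left_module R U by (rule U)
  have Cc: "C \<subseteq> carrier R" "\<And>c r. c \<in> C \<Longrightarrow> r \<in> carrier R \<Longrightarrow> c \<otimes>\<^bsub>R\<^esub> r = r \<otimes>\<^bsub>R\<^esub> c"
    using C subringE(1)[of C R] by (auto simp: central_subring_def)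
  have gadd: "g \<in> add_hom U U" and gc: "\<And>f x. f \<in> mod_hom R U U \<Longrightarrow> x \<in> carrier U \<Longrightarrow> g (f x) = f (g x)"
    using g by (auto simp: Biend_def commutant_def End_ring_def)
  show ?thesis
  proof (rule mod_homI)
    fix c x assume "c \<in> carrier (R\<lparr>carrier := C\<rparr>)" and x: "x \<in> carrier U"
    then have c: "c \<in> C" "c \<in> carrier R" using Cc(1) by auto
    have "(\<lambda>x\<in>carrier U. c \<odot>\<^bsub>U\<^esub> x) \<in> mod_hom R U U"
      by (rule mod_homI)
        (use c in \<open>auto simp: U.smult_r_distr Cc(2) simp flip: U.smult_assoc1\<close>)
    from gc[OF this x] show "g (c \<odot>\<^bsub>U\<^esub> x) = c \<odot>\<^bsub>U\<^esub> g x"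
      using x add_homD(2)[OF gadd] by simp
  qed (use add_homD[OF gadd] in auto)
qed

text \<open>If \<open>t\<close> is multiplication by \<open>c\<close> in \<open>C\<close>, then
  \<open>t \<circ> \<sigma>\<close> is \<open>\<sigma>\<close> acted on by \<open>c\<close> from the
  right, as \<open>\<sigma>\<close> is \<open>C\<close>-linear. Compatibility with \<open>t\<close>
  is thus a case of \<open>R\<close>-linearity.\<close>

lemma dual_right_End_is_bimodule_End:
  fixes R :: "('r, 'q) ring_scheme" and U :: "('r, 'u, 's) module_scheme"
    and Z :: "('r, 'z, 't) module_scheme"
  assumes C: "C \<subseteq> carrier R"
    and mult: "carrier (End_ring (R\<lparr>carrier := C\<rparr>) Z) = multiplications (R\<lparr>carrier := C\<rparr>) Z"
  shows "mod_hom R (dual_right (R\<lparr>carrier := C\<rparr>) U Z) (dual_right (R\<lparr>carrier := C\<rparr>) U Z)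
    \<subseteq> dual_bimodule_End R (R\<lparr>carrier := C\<rparr>) U Z"
proof
  let ?K = "R\<lparr>carrier := C\<rparr>"
  fix \<phi> assume \<phi>: "\<phi> \<in> mod_hom R (dual_right ?K U Z) (dual_right ?K U Z)"
  note D = mod_homD[OF \<phi>, unfolded dual_simps]
  have scal: "compose (carrier U) t \<sigma> = (\<lambda>u\<in>carrier U. \<sigma> (c \<odot>\<^bsub>U\<^esub> u))"
    if "t = (\<lambda>z\<in>carrier Z. c \<odot>\<^bsub>Z\<^esub> z)" "c \<in> C" "\<sigma> \<in> mod_hom ?K U Z" for t c \<sigma>
    using that mod_homD(2,4)[OF that(3)] by (auto simp: compose_def intro!: restrict_ext)
  have "\<phi> \<in> mod_hom (End_ring ?K Z) (dual_left ?K U Z) (dual_left ?K U Z)"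
  proof (rule mod_homI; unfold dual_simps)
    fix t \<sigma> assume t: "t \<in> carrier (End_ring ?K Z)" and \<sigma>: "\<sigma> \<in> mod_hom ?K U Z"
    from t obtain c where c: "c \<in> C" "t = (\<lambda>z\<in>carrier Z. c \<odot>\<^bsub>Z\<^esub> z)"
      unfolding mult multiplications_def by auto
    then have cR: "c \<in> carrier R" using C by blast
    show "\<phi> (compose (carrier U) t \<sigma>) = compose (carrier U) t (\<phi> \<sigma>)"
      by (simp only: scal[OF c(2,1) \<sigma>] scal[OF c(2,1) D(2)[OF \<sigma>]] D(4)[OF cR \<sigma>])
  qed (use D in auto)
  then show "\<phi> \<in> dual_bimodule_End R ?K U Z" using \<phi> by (simp add: dual_bimodule_End_def)
qed

section \<open>Adjoints of biendomorphisms\<close>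

theorem corollary4p3:
  fixes R :: "('r, 'q) ring_scheme"
    and C :: "'r set"
    and U :: "('r, 'u, 's) module_scheme"
    and Z :: "('r, 'z, 't) module_scheme"
  assumes "ring R" and "central_subring C R"
    and "left_module R U"
    and "FRCP TYPE('x) TYPE('w) R U"
    and "injective_module TYPE('r set) (R\<lparr>carrier := C\<rparr>) Z"
    and "cogenerator TYPE('r set) (R\<lparr>carrier := C\<rparr>) Z"
  shows "let K = R\<lparr>carrier := C\<rparr>; C' = End_ring K Z in
    adjoint K U Z ` Biend R U
      \<subseteq> commutant (dual_bimodule_End R K U Z) (dual_right K U Z)
        \<inter> carrier (End_ring C' (dual_left K U Z))
    \<and> (carrier C' = multiplications K Z \<longrightarrow>
        adjoint K U Z ` Biend R U \<subseteq> Biend R (dual_right K U Z))"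
proof -
  let ?K = "R\<lparr>carrier := C\<rparr>" and ?S = "mod_hom (R\<lparr>carrier := C\<rparr>) U Z"
  have C: "C \<subseteq> carrier R" using assms(2) subringE(1)[of C R] by (simp add: central_subring_def)
  have KU: "module ?K U" by (rule restricted_module[OF assms(3,2)])
  interpret KU: left_module ?K U using KU by (simp add: module_iff_left_module)
  have adj: "adjoint ?K U Z g \<in> commutant (dual_bimodule_End R ?K U Z) (dual_right ?K U Z)"
    "adjoint ?K U Z g \<in> carrier (End_ring (End_ring ?K Z) (dual_left ?K U Z))"
    if g: "g \<in> Biend R U" for g
  proof -
    have gK: "g \<in> mod_hom ?K U U" by (rule Biend_mod_hom[OF assms(2,3) g])
    note gc = mod_homD(2)[OF gK]
    have \<rho>g: "compose (carrier U) \<rho> g \<in> ?S" if "\<rho> \<in> ?S" for \<rho> by (rule KU.hom_compose[OF gK that])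
    have add: "(\<lambda>u\<in>carrier U. \<rho> u \<oplus>\<^bsub>Z\<^esub> \<sigma> u) \<in> ?S" if "\<rho> \<in> ?S" "\<sigma> \<in> ?S" for \<rho> \<sigma>
      using assms(5) by (intro module.hom_add that KU) (simp add: injective_module_def)
    have a: "adjoint ?K U Z g \<rho> = compose (carrier U) \<rho> g" if "\<rho> \<in> ?S" for \<rho>
      using that by (simp add: adjoint_def)
    have ext: "adjoint ?K U Z g \<in> extensional ?S" by (simp add: adjoint_def)
    have addh: "adjoint ?K U Z g (\<lambda>u\<in>carrier U. \<rho> u \<oplus>\<^bsub>Z\<^esub> \<sigma> u) =
        (\<lambda>u\<in>carrier U. adjoint ?K U Z g \<rho> u \<oplus>\<^bsub>Z\<^esub> adjoint ?K U Z g \<sigma> u)" if "\<rho> \<in> ?S" "\<sigma> \<in> ?S" for \<rho> \<sigma>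
      using that add[OF that] by (auto simp: a compose_def gc intro!: restrict_ext)
    \<comment> \<open>The adjoint of \<open>g\<close> composes on the right and \<open>t\<close> on
      the left, so the two commute.\<close>
    have "adjoint ?K U Z g \<in> mod_hom (End_ring ?K Z) (dual_left ?K U Z) (dual_left ?K U Z)"
    proof (rule mod_homI; unfold dual_simps)
      fix t \<rho> assume "t \<in> carrier (End_ring ?K Z)" and \<rho>: "\<rho> \<in> ?S"
      then have "compose (carrier U) t \<rho> \<in> ?S" by (auto simp: End_ring_def intro: KU.hom_compose)
      then show "adjoint ?K U Z g (compose (carrier U) t \<rho>) =
          compose (carrier U) t (adjoint ?K U Z g \<rho>)"
        using \<rho> by (auto simp: a compose_def gc intro!: restrict_ext)
    qed (use ext addh in \<open>auto simp: a \<rho>g\<close>)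
    then show "adjoint ?K U Z g \<in> carrier (End_ring (End_ring ?K Z) (dual_left ?K U Z))"
      by (simp add: End_ring_def)
    have "adjoint ?K U Z g \<in> add_hom (dual_right ?K U Z) (dual_right ?K U Z)"
      using ext addh by (auto simp: add_hom_def dual_simps PiE_iff a \<rho>g)
    moreover have "adjoint ?K U Z g (\<phi> \<rho>) = \<phi> (adjoint ?K U Z g \<rho>)"
      if \<phi>: "\<phi> \<in> dual_bimodule_End R ?K U Z" and \<rho>: "\<rho> \<in> ?S" for \<phi> \<rho>
    proof -
      have \<phi>S: "\<phi> \<sigma> \<in> ?S" if "\<sigma> \<in> ?S" for \<sigma>
        using \<phi> mod_homD(2)[of \<phi> R "dual_right ?K U Z" "dual_right ?K U Z" \<sigma>] that
        by (simp add: dual_bimodule_End_def dual_simps)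
      have "compose (carrier U) (\<phi> \<rho>) g = \<phi> (compose (carrier U) \<rho> g)"
      proof (rule extensionalityI[of _ "carrier U"])
        show "\<phi> (compose (carrier U) \<rho> g) \<in> extensional (carrier U)"
          by (rule mod_homD(1)[OF \<phi>S[OF \<rho>g[OF \<rho>]]])
        fix u assume u: "u \<in> carrier U"
        \<comment> \<open>One \<open>f\<close> has to serve both pairs: \<open>\<rho>\<close> at
          \<open>g u\<close>, and \<open>\<rho> \<circ> g\<close> at \<open>u\<close>. Commuting
          \<open>f\<close> with \<open>g\<close> then identifies the two values.\<close>
        obtain f where f: "f \<in> mod_hom R U U" "\<rho> (f (g u)) = \<phi> \<rho> (g u)"
          "compose (carrier U) \<rho> g (f u) = \<phi> (compose (carrier U) \<rho> g) u"
          by (rule dual_End_interpolation[OF assms(2-6) \<phi> \<rho> \<rho>g[OF \<rho>] gc[OF u] u])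
        have "g (f u) = f (g u)"
          using g f(1) u by (simp add: Biend_def commutant_def End_ring_def)
        then show "compose (carrier U) (\<phi> \<rho>) g u = \<phi> (compose (carrier U) \<rho> g) u"
          using f u mod_homD(2)[OF f(1) u] by (simp add: compose_eq)
      qed simp
      then show ?thesis using \<rho> \<phi>S by (simp add: a)
    qed
    ultimately show "adjoint ?K U Z g \<in> commutant (dual_bimodule_End R ?K U Z) (dual_right ?K U Z)"
      by (auto simp: commutant_def dual_simps)
  qed
  \<comment> \<open>When all endomorphisms of \<open>Z\<close> are multiplications, the bimodule
    endomorphisms include every \<open>R\<close>-endomorphism of the dual, so commuting with the
    former is at least as strong.\<close>
  have "Biend R (dual_right ?K U Z) \<supseteq> commutant (dual_bimodule_End R ?K U Z) (dual_right ?K U Z)"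
    if "carrier (End_ring ?K Z) = multiplications ?K Z"
    using dual_right_End_is_bimodule_End[OF C that, of U]
    unfolding Biend_def commutant_def by (auto simp: End_ring_def)
  with adj show ?thesis unfolding Let_def by blast
qed

end
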